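(* Let $m\ge1$ and let $(X_t)$ be a strictly stationary, $m$-dependent, real-valued sequence with $\mathbb{E}[X]=0$ which is regularly varying with index $\alpha>2$. Let $F$ be its marginal distribution, $\overline F=1-F$, and $S_n=X_1+\cdots+X_n$. Let $(t_n)$ be a positive sequence and assume the following. (RV1) $\displaystyle\lim_{n\to\infty}\frac{t_n}{\sqrt{n\log n}}=\infty$. (RV2) $\overline F(x)=L(x)x^{-\alpha}$ for a slowly varying function $L$, and the tail balance condition holds: $\mathbb{P}(X>x)/\mathbb{P}(|X|>x)\to p_+$ and $\mathbb{P}(-X>x)/\mathbb{P}(|X|>x)\to p_-$ as $x\to\infty$ for some $p_+>0$, $p_-\ge0$. (RV3) For $h=1,\ldots,m$, $\displaystyle\lim_{x\to\infty}\mathbb{P}\big(|X_h|>x\;\big|\;|X_0|>x\big)=0$. Then $$\lim_{n\to\infty}\sup_{x>t_n\delta}\Big|\frac{\mathbb{P}(S_n>x)}{n\,\overline F(x)}-1\Big|=0\qquad\text{for every }\delta>0.$$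
   Context: $X$ denotes a generic element of the stationary sequence $(X_t)$. A sequence is $m$-dependent if $(X_t)_{t\le k}$ and $(X_t)_{t>k+m}$ are independent for every $k$. A random vector $\mathbf X$ in $\mathbb{R}^d$ is regularly varying with index $\alpha>0$ if, as $x\to\infty$, the conditional law $\mathbb{P}\big((\mathbf X/x,\mathbf X/|\mathbf X|)\in\cdot\;\big|\;|\mathbf X|>x\big)$ converges weakly to the law of $(Y,\mathbf\Theta)$ (the limit of $|\mathbf X|/x$ being $Y$ and that of $\mathbf X/|\mathbf X|$ being $\mathbf\Theta$), where $Y$ is Pareto distributed, $\mathbb{P}(Y>y)=y^{-\alpha}$ for $y>1$, and $Y$ is independent of $\mathbf\Theta$. A stationary sequence $(X_t)$ is regularly varying with index $\alpha$ if every lagged vector $(X_0,\ldots,X_h)$, $h\ge0$, is regularly varying with index $\alpha$. *)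

theory Defs
  imports "HOL-Probability.Probability"
begin

definition strictly_stationary :: "'w measure \<Rightarrow> (int \<Rightarrow> 'w \<Rightarrow> real) \<Rightarrow> bool" where
  "strictly_stationary M X \<longleftrightarrow>
     (\<forall>t. X t \<in> borel_measurable M) \<and>
     (\<forall>J k. finite J \<longrightarrow>
        distr M (Pi\<^sub>M J (\<lambda>_. borel)) (\<lambda>\<omega>. \<lambda>t\<in>J. X (t + k) \<omega>) =
        distr M (Pi\<^sub>M J (\<lambda>_. borel)) (\<lambda>\<omega>. \<lambda>t\<in>J. X t \<omega>))"

definition m_dependent :: "'w measure \<Rightarrow> nat \<Rightarrow> (int \<Rightarrow> 'w \<Rightarrow> real) \<Rightarrow> bool" where
  "m_dependent M m X \<longleftrightarrow>
     (\<forall>k. prob_space.indep_var M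
        (Pi\<^sub>M {..k} (\<lambda>_. borel)) (\<lambda>\<omega>. \<lambda>t\<in>{..k}. X t \<omega>)
        (Pi\<^sub>M {k + int m<..} (\<lambda>_. borel)) (\<lambda>\<omega>. \<lambda>t\<in>{k + int m<..}. X t \<omega>))"

text \<open>Weak convergence of laws on a topological space; the library notion \<open>weak_conv_m\<close>
  covers only sequences of measures on the real line.\<close>

definition weakly_converges ::
  "('i \<Rightarrow> 'a::topological_space measure) \<Rightarrow> 'a measure \<Rightarrow> 'i filter \<Rightarrow> bool" where
  "weakly_converges \<mu> \<nu> A \<longleftrightarrow>
     (\<forall>f :: 'a \<Rightarrow> real. continuous_on UNIV f \<and> bounded (range f) \<longrightarrow>
        ((\<lambda>i. \<integral>z. f z \<partial>\<mu> i) \<longlongrightarrow> (\<integral>z. f z \<partial>\<nu>)) A)"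

text \<open>The dimension of the lagged vectors varies within one statement, so a vector in
  \<open>\<real>\<^sup>d\<close> is a function \<open>nat \<Rightarrow> real\<close> vanishing outside \<open>{..<d}\<close>, as in \<^const>\<open>Euclidean_space\<close>.
  The product topology on \<open>nat \<Rightarrow> real\<close> induces the usual topology on this closed subspace.
  \<open>\<bar>\<cdot>\<bar>\<close> is the Euclidean norm.

  \<open>uniform_measure M A\<close> is the conditional law given the event \<open>A\<close>. The measures \<open>\<nu>\<close> and \<open>\<Theta>\<close>
  are the laws of the Pareto variable and of the spectral vector; their independence is
  expressed by the product measure.\<close>

definition regularly_varying_vector ::
  "'w measure \<Rightarrow> nat \<Rightarrow> ('w \<Rightarrow> nat \<Rightarrow> real) \<Rightarrow> real \<Rightarrow> bool" where
  "regularly_varying_vector M d Z \<alpha> \<longleftrightarrow>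
     Z \<in> borel_measurable M \<and> Z \<in> space M \<rightarrow> topspace (Euclidean_space d) \<and> \<alpha> > 0 \<and>
     (\<exists>(\<nu> :: real measure) (\<Theta> :: (nat \<Rightarrow> real) measure).
        prob_space \<nu> \<and> sets \<nu> = sets borel \<and> (\<forall>y>1. measure \<nu> {y<..} = y powr (- \<alpha>)) \<and>
        prob_space \<Theta> \<and> sets \<Theta> = sets borel \<and>
        weakly_converges
          (\<lambda>x. distr (uniform_measure M {\<omega> \<in> space M. L2_set (Z \<omega>) {..<d} > x}) borel
                 (\<lambda>\<omega>. (L2_set (Z \<omega>) {..<d} / x, \<lambda>i. Z \<omega> i / L2_set (Z \<omega>) {..<d})))
          (\<nu> \<Otimes>\<^sub>M \<Theta>) at_top)"

definition regularly_varying_sequence ::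
  "'w measure \<Rightarrow> (int \<Rightarrow> 'w \<Rightarrow> real) \<Rightarrow> real \<Rightarrow> bool" where
  "regularly_varying_sequence M X \<alpha> \<longleftrightarrow>
     (\<forall>h::nat. regularly_varying_vector M (Suc h)
        (\<lambda>\<omega> i. if i \<le> h then X (int i) \<omega> else 0) \<alpha>)"

definition slowly_varying :: "(real \<Rightarrow> real) \<Rightarrow> bool" where
  "slowly_varying L \<longleftrightarrow>
     (\<exists>a>0. L \<in> borel_measurable (restrict_space borel {a..}) \<and> (\<forall>x\<ge>a. L x > 0)) \<and>
     (\<forall>c>0. ((\<lambda>x. L (c * x) / L x) \<longlongrightarrow> 1) at_top)"

definition right_tail :: "'w measure \<Rightarrow> ('w \<Rightarrow> real) \<Rightarrow> real \<Rightarrow> real" where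
  "right_tail M Y x = 1 - cdf (distr M borel Y) x"

end

theory Submission
  imports Defs "HOL-Real_Asymp.Real_Asymp"
begin

text \<open>A heavy-tailed sum is large because one summand is. Fix a level \<open>x\<close>, truncate every
  summand at \<open>\<epsilon> x\<close>, and let \<open>T\<close> be the sum of the truncated variables. Three things
  can push \<open>S\<close> above \<open>x\<close>.

  \<^item> Exactly one summand exceeds \<open>\<epsilon> x\<close> in absolute value and \<open>T\<close> is moderate. Then
  that summand lies essentially above \<open>x\<close>, which costs \<open>n G(x)\<close> up to a factor close to one, \<open>G\<close>
  being the right tail. The deterministic identity is \<open>sum_eq_trunc_plus_jump\<close>; the resulting two-sided
  bounds are \<open>prob_sum_gt_le\<close> and \<open>prob_sum_gt_ge\<close>, the latter through Bonferroni's inequality.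

  \<^item> Two summands exceed \<open>\<epsilon> x\<close>. If their indices differ by more than \<open>m\<close> they are
  independent and the pair costs \<open>P(|X| > \<epsilon> x)\<^sup>2\<close>. There are at most \<open>n\<^sup>2\<close> such pairs, and
  \<open>n P(|X| > \<epsilon> x)\<close> tends to zero by Chebyshev's inequality. The at most \<open>m n\<close> close pairs are
  negligible because joint exceedances at lags \<open>1, \<dots>, m\<close> are rare relative to single ones. This is \<open>sum_prob_pairs_le\<close>.

  \<^item> The truncated sum exceeds a fixed fraction of \<open>x\<close>. Indices in one residue class modulo
  \<open>m + 1\<close> carry independent variables, so Chernoff's bound applies class by class
  (\<open>truncated_sum_chernoff\<close>). With exponent \<open>h = A ln x / x\<close> the factor \<open>exp (- h c x)\<close> is a power of
  \<open>x\<close> as small as desired. The logarithm of the moment generating function of a class is at most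
  \<open>2 + ln x\<close>: this uses \<open>E X\<^sup>2 < \<infinity>\<close>, \<open>E |X|\<^sup>q < \<infinity>\<close> for some \<open>q > 2\<close>, a
  small \<open>\<epsilon>\<close>, and \<open>n ln x = o(x\<^sup>2)\<close>. Since \<open>G\<close> decays only polynomially, the bound is
  \<open>o(G(x))\<close> (\<open>truncated_sum_negligible\<close>).

  All error terms are controlled as soon as \<open>x\<close> is large and \<open>n ln x / x\<^sup>2\<close> is small
  (\<open>big_jump_uniform\<close>), and \<open>t\<^sub>n\<close> growing faster than \<open>sqrt (n ln n)\<close> ensures that every \<open>x > \<delta> t\<^sub>n\<close> is
  eventually of this kind (\<open>eventually_log_regime\<close>). Regular variation enters
  through the limits of \<open>G(c x) / G(x)\<close>, which tail balance carries over to \<open>P(|X| > x)\<close>. Monotonicity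
  of the tails turns the case \<open>c = 2\<close> into a polynomial lower bound for \<open>G\<close> and into finite moments of
  order below \<open>\<alpha>\<close>; the case \<open>c = \<epsilon>\<close> compares \<open>P(|X| > \<epsilon> x)\<close> with \<open>G(x)\<close>; the cases
  \<open>c = 1 \<plusminus> \<delta>\<close> absorb the moderate fluctuation of \<open>T\<close>.\<close>

section \<open>Monotone functions with a dyadic limit ratio\<close>

text \<open>For a monotone function a limit along the single ratio 2 already gives the lower half of Potter's
  bounds, with a non-optimal exponent: each doubling loses at most a fixed factor \<open>2 powr - \<gamma>\<close>, and
  monotonicity interpolates between consecutive points \<open>2\<^sup>k x\<^sub>0\<close>.\<close>

lemma dyadic_lower_bound:
  fixes f :: "real \<Rightarrow> real"
  assumes anti: "\<And>x y. x \<le> y \<Longrightarrow> f y \<le> f x"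
    and pos: "\<And>x. a \<le> x \<Longrightarrow> 0 < f x"
    and ratio: "((\<lambda>x. f (2 * x) / f x) \<longlongrightarrow> l) at_top" and "0 < l"
  shows "\<exists>\<gamma>>0. \<exists>c>0. \<exists>x0. \<forall>x\<ge>x0. c * x powr - \<gamma> \<le> f x"
proof -
  obtain \<gamma> :: real where \<gamma>: "\<gamma> > 0" "2 powr - \<gamma> < l"
  proof -
    have "((\<lambda>g::real. 2 powr - g) \<longlongrightarrow> 0) at_top" by real_asymp
    then have "eventually (\<lambda>g::real. 2 powr - g < l) at_top"
      using \<open>0 < l\<close> by (rule order_tendstoD)
    then have "eventually (\<lambda>g::real. 2 powr - g < l \<and> g > 0) at_top"
      using eventually_gt_at_top by (rule eventually_conj)
    then show ?thesis using that by (auto simp: eventually_at_top_linorder)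
  qed
  have "eventually (\<lambda>x. 2 powr - \<gamma> < f (2 * x) / f x) at_top"
    using ratio \<gamma>(2) by (rule order_tendstoD)
  then obtain b where b: "\<And>x. x \<ge> b \<Longrightarrow> 2 powr - \<gamma> < f (2 * x) / f x"
    by (auto simp: eventually_at_top_linorder)
  define x0 where "x0 = max 1 (max a b)"
  have x0: "x0 \<ge> 1" "x0 \<ge> a" "x0 \<ge> b" by (auto simp: x0_def)
  have step: "2 powr - \<gamma> * f x \<le> f (2 * x)" if "x \<ge> x0" for x
    using b[of x] pos[of x] that x0 by (simp add: field_simps)
  have iter: "(2 powr - \<gamma>) ^ k * f x0 \<le> f (2 ^ k * x0)" for k
  proof (induction k)
    case (Suc k)
    have ge: "2 ^ k * x0 \<ge> x0" using x0 by simp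
    have "(2 powr - \<gamma>) ^ Suc k * f x0 \<le> 2 powr - \<gamma> * f (2 ^ k * x0)"
      using mult_left_mono[OF Suc, of "2 powr - \<gamma>"] by (simp add: mult.assoc)
    also have "\<dots> \<le> f (2 ^ Suc k * x0)" using step[OF ge] by (simp add: mult.assoc)
    finally show ?case .
  qed simp
  define c where "c = 2 powr - \<gamma> * f x0 * x0 powr \<gamma>"
  have "c * x powr - \<gamma> \<le> f x" if "x \<ge> x0" for x
  proof -
    obtain k where k: "2 ^ k \<le> x / x0" "x / x0 < 2 ^ (k + 1)"
    proof -
      have "1 \<le> x / x0" using \<open>x \<ge> x0\<close> x0 by simp
      define k where "k = nat \<lfloor>log 2 (x / x0)\<rfloor>"
      have l0: "0 \<le> log 2 (x / x0)" using \<open>1 \<le> x / x0\<close> by simp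
      have "real k \<le> log 2 (x / x0)" "log 2 (x / x0) < real (k + 1)"
        unfolding k_def using l0 by linarith+
      then have "2 powr real k \<le> x / x0" "x / x0 < 2 powr real (k + 1)"
        using \<open>1 \<le> x / x0\<close> by (simp_all only: le_log_iff log_less_iff)
      then show ?thesis using that by (simp_all only: powr_realpow zero_less_numeral)
    qed
    have "c * x powr - \<gamma> = 2 powr - \<gamma> * f x0 * (x / x0) powr - \<gamma>"
      using x0 that by (simp add: c_def powr_divide powr_minus field_simps)
    also have "\<dots> \<le> 2 powr - \<gamma> * f x0 * (2 ^ k) powr - \<gamma>"
      using k \<gamma> pos[OF x0(2)] by (intro mult_left_mono powr_mono2') auto
    also have "(2 ^ k) powr - \<gamma> = (2 powr - \<gamma>) ^ k" 
      by (simp add: powr_powr powr_realpow[symmetric] mult.commute)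
    also have "2 powr - \<gamma> * f x0 * (2 powr - \<gamma>) ^ k = (2 powr - \<gamma>) ^ (k + 1) * f x0" by simp
    also have "\<dots> \<le> f (2 ^ (k + 1) * x0)" by (rule iter)
    also have "\<dots> \<le> f x" using k x0 by (intro anti) (simp add: field_simps)
    finally show ?thesis .
  qed
  moreover have "c > 0" using pos[OF x0(2)] x0 by (simp add: c_def)
  ultimately show ?thesis using \<gamma>(1) by blast
qed

section \<open>Moments, truncation and Bonferroni's inequality\<close>

text \<open>Below 1 the quadratic Taylor term suffices. Above 1 the full exponential is paid for by \<open>\<bar>u\<bar> powr q \<ge> 1\<close>,
  at the price of the factor \<open>exp b\<close>; this is where a moment of order \<open>q\<close> takes over from the second one.\<close>

lemma exp_le_quadratic_plus_powr:
  fixes u b q :: real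
  assumes "u \<le> b" "0 \<le> q"
  shows "exp u \<le> 1 + u + u\<^sup>2 + exp b * \<bar>u\<bar> powr q"
proof -
  consider "u \<le> 0" | "0 \<le> u" "u \<le> 1" | "u > 1" by linarith
  then show ?thesis
  proof cases
    case 1
    define v where "v = - u"
    have v: "v \<ge> 0" using 1 by (simp add: v_def)
    have "0 < (v - 1 / 2)\<^sup>2 + 3 / 4" by (simp add: add_nonneg_pos)
    then have pos: "0 < 1 - v + v\<^sup>2" by (simp add: power2_eq_square algebra_simps)
    \<comment> \<open>The claim \<open>exp (- v) \<le> 1 - v + v\<^sup>2\<close> follows from \<open>exp v \<ge> 1 + v + v\<^sup>2 / 2\<close>.\<close>
    have "1 \<le> (1 + v + v\<^sup>2 / 2) * (1 - v + v\<^sup>2)"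
    proof -
      have "(1 + v + v\<^sup>2 / 2) * (1 - v + v\<^sup>2) = 1 + v\<^sup>2 / 2 + v ^ 3 / 2 + v ^ 4 / 2"
        by (simp add: field_simps power2_eq_square power3_eq_cube power4_eq_xxxx)
      then show ?thesis using v by simp
    qed
    also have "\<dots> \<le> exp v * (1 - v + v\<^sup>2)"
      using exp_lower_Taylor_quadratic[OF v] pos by (intro mult_right_mono) auto
    finally have "exp (- v) \<le> 1 - v + v\<^sup>2" by (simp add: exp_minus field_simps)
    moreover have "0 \<le> exp b * \<bar>u\<bar> powr q" by simp
    ultimately show ?thesis unfolding v_def by (simp, linarith)
  next
    case 2
    have "0 \<le> exp b * \<bar>u\<bar> powr q" by simp
    then show ?thesis using exp_bound[of u] 2 by linarith
  next
    case 3
    have "1 \<le> u powr q" using 3 assms by (simp add: ge_one_powr_ge_zero)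
    then have "exp u * 1 \<le> exp b * u powr q" using assms by (intro mult_mono) auto
    moreover have "0 \<le> 1 + u + u\<^sup>2" using 3 by simp
    moreover have "\<bar>u\<bar> = u" using 3 by simp
    ultimately show ?thesis by (simp, linarith)
  qed
qed

definition trunc :: "real \<Rightarrow> real \<Rightarrow> real" where
  "trunc y v = (if \<bar>v\<bar> \<le> y then v else 0)"

lemma trunc_measurable [measurable]: "trunc y \<in> borel_measurable borel"
  unfolding trunc_def[abs_def] by measurable

lemma abs_trunc_le: "0 \<le> y \<Longrightarrow> \<bar>trunc y v\<bar> \<le> y" "\<bar>trunc y v\<bar> \<le> \<bar>v\<bar>"
  by (auto simp: trunc_def)

context prob_space begin

text \<open>On the shell \<open>2\<^sup>k a < \<bar>Z\<bar> \<le> 2\<^sup>k\<^sup>+\<^sup>1 a\<close> the integrand is at most a multiple of \<open>2 powr (q k)\<close>, while the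
  shell has probability at most \<open>2 powr (- \<beta> k)\<close>, so the moment is bounded by a geometric series.\<close>

lemma integrable_abs_powr_of_dyadic_decay:
  fixes Z :: "'a \<Rightarrow> real"
  assumes [measurable]: "Z \<in> borel_measurable M"
    and "0 < q" "q < \<beta>"
    and decay: "\<And>x. x0 \<le> x \<Longrightarrow>
      prob {\<omega>\<in>space M. \<bar>Z \<omega>\<bar> > 2 * x} \<le> 2 powr - \<beta> * prob {\<omega>\<in>space M. \<bar>Z \<omega>\<bar> > x}"
  shows "integrable M (\<lambda>\<omega>. \<bar>Z \<omega>\<bar> powr q)"
proof -
  define a where "a = max x0 1"
  have a: "a \<ge> 1" "a \<ge> x0" by (auto simp: a_def)
  define B where "B k = {\<omega>\<in>space M. \<bar>Z \<omega>\<bar> > 2 ^ k * a}" for k :: nat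
  have B [measurable]: "B k \<in> sets M" for k unfolding B_def by measurable
  have probB: "prob (B k) \<le> (2 powr - \<beta>) ^ k" for k
  proof (induction k)
    case (Suc k)
    have "x0 \<le> 2 ^ k * a" using a one_le_power[of "2::real" k]
      by (smt (verit) mult_le_cancel_right1)
    from decay[OF this] have "prob (B (Suc k)) \<le> 2 powr - \<beta> * prob (B k)"
      by (simp add: B_def mult.assoc)
    also have "\<dots> \<le> 2 powr - \<beta> * (2 powr - \<beta>) ^ k" using Suc by (intro mult_left_mono) auto
    finally show ?case by simp
  qed simp
  define w where "w k = (2 ^ (k + 1) * a) powr q" for k :: nat
  define r where "r = 2 powr (q - \<beta>)"
  have r: "0 < r" "r < 1" using assms by (auto simp: r_def powr_less_one)
  have wB: "w k * prob (B k) \<le> (2 * a) powr q * r ^ k" for k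
  proof -
    have "w k = (2 * a) powr q * (2 powr q) ^ k"
      using a by (simp add: w_def powr_mult powr_power powr_realpow[symmetric] powr_powr mult.commute mult.left_commute
        flip: powr_add powr_realpow)
    then have "w k * prob (B k) \<le> (2 * a) powr q * (2 powr q) ^ k * (2 powr - \<beta>) ^ k"
      using probB[of k] by (intro mult_mono) auto
    also have "\<dots> = (2 * a) powr q * r ^ k"
      by (simp add: r_def mult.assoc flip: power_mult_distrib powr_add)
    finally show ?thesis .
  qed
  have bound: "ennreal (\<bar>Z \<omega>\<bar> powr q) \<le> ennreal (a powr q) + (\<Sum>k. ennreal (w k) * indicator (B k) \<omega>)"
    if "\<omega> \<in> space M" for \<omega>
  proof (cases "\<bar>Z \<omega>\<bar> \<le> a")
    case True
    then have "ennreal (\<bar>Z \<omega>\<bar> powr q) \<le> ennreal (a powr q)"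
      using assms by (intro ennreal_leI powr_mono2) auto
    then show ?thesis by (rule order_trans) simp
  next
    case False
    define z where "z = \<bar>Z \<omega>\<bar> / a"
    have z: "1 < z" using False a by (simp add: z_def)
    define k where "k = nat (\<lceil>log 2 z\<rceil> - 1)"
    have l0: "0 < log 2 z" using z by simp
    have "real k < log 2 z" "log 2 z \<le> real (k + 1)"
      unfolding k_def using l0 by linarith+
    then have "2 powr real k < z" "z \<le> 2 powr real (k + 1)"
      using z by (simp_all only: log_le_iff less_log_iff)
    then have k: "2 ^ k < z" "z \<le> 2 ^ (k + 1)" by (simp_all only: powr_realpow zero_less_numeral)
    have "\<omega> \<in> B k" using k(1) a that by (simp add: B_def z_def field_simps)
    moreover have "\<bar>Z \<omega>\<bar> powr q \<le> w k"
      unfolding w_def using k(2) a assms by (intro powr_mono2) (auto simp: z_def field_simps)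
    ultimately have "ennreal (\<bar>Z \<omega>\<bar> powr q) \<le> ennreal (w k) * indicator (B k) \<omega>"
      by (simp add: ennreal_leI)
    also have "\<dots> \<le> (\<Sum>k. ennreal (w k) * indicator (B k) \<omega>)"
      using sum_le_suminf[OF summableI, of "{k}" "\<lambda>k. ennreal (w k) * indicator (B k) \<omega>"]
      by (simp del: sum_mult_indicator)
    finally show ?thesis by (rule order_trans) simp
  qed
  have "(\<integral>\<^sup>+\<omega>. ennreal (\<bar>Z \<omega>\<bar> powr q) \<partial>M)
      \<le> (\<integral>\<^sup>+\<omega>. ennreal (a powr q) + (\<Sum>k. ennreal (w k) * indicator (B k) \<omega>) \<partial>M)"
    by (intro nn_integral_mono bound)
  also have "\<dots> = ennreal (a powr q) + (\<Sum>k. ennreal (w k) * emeasure M (B k))"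
    by (simp add: nn_integral_add nn_integral_suminf nn_integral_cmult_indicator emeasure_space_1)
  also have "(\<Sum>k. ennreal (w k) * emeasure M (B k)) \<le> (\<Sum>k. ennreal ((2 * a) powr q * r ^ k))"
  proof (intro suminf_le allI)
    fix k
    have "ennreal (w k) * emeasure M (B k) = ennreal (w k * prob (B k))"
      by (simp add: emeasure_eq_measure ennreal_mult w_def)
    then show "ennreal (w k) * emeasure M (B k) \<le> ennreal ((2 * a) powr q * r ^ k)"
      using wB by (simp add: ennreal_leI)
  qed auto
  also have "\<dots> = ennreal (\<Sum>k. (2 * a) powr q * r ^ k)"
    using r by (intro suminf_ennreal2 summable_mult summable_geometric) auto
  finally have "(\<integral>\<^sup>+\<omega>. ennreal (\<bar>Z \<omega>\<bar> powr q) \<partial>M) < \<infinity>"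
    by (auto simp: top.not_eq_extremum intro: le_less_trans)
  then show ?thesis by (intro integrableI_nonneg) auto
qed

text \<open>The drift of the truncated variable is the only first-order contribution. Since \<open>Z\<close> is centred it equals
  minus the expectation of the part cut off, and \<open>\<bar>Z\<bar> \<le> Z\<^sup>2 / y\<close> there.\<close>

lemma mgf_trunc_le:
  fixes Z :: "'a \<Rightarrow> real"
  assumes [measurable]: "Z \<in> borel_measurable M"
    and int1: "integrable M Z" and mean: "expectation Z = 0"
    and int2: "integrable M (\<lambda>\<omega>. (Z \<omega>)\<^sup>2)" and intq: "integrable M (\<lambda>\<omega>. \<bar>Z \<omega>\<bar> powr q)"
    and "0 \<le> h" "0 < y" "0 < q"
  shows "expectation (\<lambda>\<omega>. exp (h * trunc y (Z \<omega>)))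
     \<le> exp (h * expectation (\<lambda>\<omega>. (Z \<omega>)\<^sup>2) / y + h\<^sup>2 * expectation (\<lambda>\<omega>. (Z \<omega>)\<^sup>2)
          + exp (h * y) * h powr q * expectation (\<lambda>\<omega>. \<bar>Z \<omega>\<bar> powr q))"
    (is "?L \<le> exp (h * ?V / y + h\<^sup>2 * ?V + ?E * ?W)")
proof -
  let ?Y = "\<lambda>\<omega>. trunc y (Z \<omega>)"
  have intY: "integrable M ?Y"
    by (rule Bochner_Integration.integrable_bound[OF int1]) (auto simp: abs_trunc_le)
  have drift: "expectation ?Y \<le> ?V / y"
  proof -
    have "expectation ?Y = expectation (\<lambda>\<omega>. ?Y \<omega> - Z \<omega>)"
      using intY int1 mean by simp
    also have "\<dots> \<le> expectation (\<lambda>\<omega>. (Z \<omega>)\<^sup>2 / y)"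
    proof (intro integral_mono)
      fix \<omega>
      show "?Y \<omega> - Z \<omega> \<le> (Z \<omega>)\<^sup>2 / y"
      proof (cases "\<bar>Z \<omega>\<bar> \<le> y")
        case False
        then have "\<bar>Z \<omega>\<bar> * y \<le> \<bar>Z \<omega>\<bar> * \<bar>Z \<omega>\<bar>" by (intro mult_left_mono) auto
        then have "\<bar>Z \<omega>\<bar> \<le> (Z \<omega>)\<^sup>2 / y" using \<open>0 < y\<close> by (simp add: field_simps power2_eq_square)
        then show ?thesis using False by (simp add: trunc_def)
      qed (use \<open>0 < y\<close> in \<open>simp add: trunc_def\<close>)
    qed (use int1 int2 intY in auto)
    also have "\<dots> = ?V / y" by simp
    finally show ?thesis .
  qed
  have "?L \<le> expectation (\<lambda>\<omega>. 1 + h * ?Y \<omega> + h\<^sup>2 * (Z \<omega>)\<^sup>2 + ?E * \<bar>Z \<omega>\<bar> powr q)"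
  proof (intro integral_mono)
    show "integrable M (\<lambda>\<omega>. exp (h * ?Y \<omega>))"
    proof (rule integrable_const_bound[where B = "exp (h * y)"], rule AE_I2)
      fix \<omega>
      have "?Y \<omega> \<le> y" using abs_trunc_le(1)[of y "Z \<omega>"] \<open>0 < y\<close> by linarith
      then show "norm (exp (h * ?Y \<omega>)) \<le> exp (h * y)" using \<open>0 \<le> h\<close> by (simp add: mult_left_mono)
    qed measurable
    fix \<omega>
    have "?Y \<omega> \<le> y" using abs_trunc_le(1)[of y "Z \<omega>"] \<open>0 < y\<close> by linarith
    then have "exp (h * ?Y \<omega>) \<le> 1 + h * ?Y \<omega> + (h * ?Y \<omega>)\<^sup>2 + exp (h * y) * \<bar>h * ?Y \<omega>\<bar> powr q"
      using assms by (intro exp_le_quadratic_plus_powr mult_left_mono) auto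
    moreover have "(h * ?Y \<omega>)\<^sup>2 \<le> h\<^sup>2 * (Z \<omega>)\<^sup>2"
      using abs_trunc_le(2)[of y "Z \<omega>"] by (simp add: power_mult_distrib mult_left_mono abs_le_square_iff)
    moreover have "\<bar>h * ?Y \<omega>\<bar> powr q \<le> h powr q * \<bar>Z \<omega>\<bar> powr q"
      using abs_trunc_le(2)[of y "Z \<omega>"] assms by (simp add: abs_mult powr_mult mult_left_mono powr_mono2)
    then have "exp (h * y) * \<bar>h * ?Y \<omega>\<bar> powr q \<le> ?E * \<bar>Z \<omega>\<bar> powr q"
      by (simp add: mult.assoc)
    ultimately show "exp (h * ?Y \<omega>) \<le> 1 + h * ?Y \<omega> + h\<^sup>2 * (Z \<omega>)\<^sup>2 + ?E * \<bar>Z \<omega>\<bar> powr q"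
      by linarith
  qed (use intY int2 intq in auto)
  also have "\<dots> = 1 + h * expectation ?Y + h\<^sup>2 * ?V + ?E * ?W"
    using intY int2 intq by (simp add: prob_space)
  also have "\<dots> \<le> 1 + (h * ?V / y + h\<^sup>2 * ?V + ?E * ?W)"
    using mult_left_mono[OF drift \<open>0 \<le> h\<close>] by simp
  also have "\<dots> \<le> exp (h * ?V / y + h\<^sup>2 * ?V + ?E * ?W)" by (rule exp_ge_add_one_self)
  finally show ?thesis .
qed

text \<open>The second Bonferroni inequality: adding \<open>A (n + 1)\<close> to the union loses at most its intersections with the
  earlier sets.\<close>

lemma prob_UN_ge_bonferroni:
  fixes A :: "nat \<Rightarrow> 'a set"
  assumes "\<And>i. A i \<in> events"
  shows "(\<Sum>j=1..n. prob (A j)) - (\<Sum>j=1..n. \<Sum>i\<in>{1..<j}. prob (A i \<inter> A j)) \<le> prob (\<Union>j\<in>{1..n}. A j)"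
proof (induction n)
  case (Suc n)
  let ?U = "\<Union>j\<in>{1..n}. A j"
  have [measurable]: "?U \<in> events" using assms by auto
  have "prob (?U \<inter> A (Suc n)) = prob (\<Union>i\<in>{1..<Suc n}. A i \<inter> A (Suc n))"
    by (rule arg_cong[where f = prob]) (auto simp flip: atLeastLessThanSuc_atLeastAtMost)
  also have "\<dots> \<le> (\<Sum>i\<in>{1..<Suc n}. prob (A i \<inter> A (Suc n)))"
    using assms by (intro finite_measure_subadditive_finite) auto
  finally have "prob (?U \<inter> A (Suc n)) \<le> (\<Sum>i\<in>{1..<Suc n}. prob (A i \<inter> A (Suc n)))" .
  moreover have "prob (?U \<union> A (Suc n)) = prob ?U + prob (A (Suc n)) - prob (?U \<inter> A (Suc n))"
    using assms by (intro measure_Un3) (auto simp: fmeasurable_eq_sets)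
  moreover have "(\<Union>j\<in>{1..Suc n}. A j) = ?U \<union> A (Suc n)" 
    by (simp add: atLeastAtMostSuc_conv Un_commute)
  ultimately show ?case using Suc by simp
qed simp

end

section \<open>Stationary m-dependent processes\<close>

locale m_dependent_process = prob_space M for M :: "'w measure" +
  fixes X :: "int \<Rightarrow> 'w \<Rightarrow> real" and m :: nat
  assumes stationary: "strictly_stationary M X" and dependent: "m_dependent M m X"
begin

lemma X_measurable [measurable]: "X t \<in> borel_measurable M"
  using stationary by (simp add: strictly_stationary_def)

lemma restrict_X_measurable [measurable]:
  "(\<lambda>\<omega>. \<lambda>t\<in>J. X (t + k) \<omega>) \<in> M \<rightarrow>\<^sub>M Pi\<^sub>M J (\<lambda>_. borel)"
  by (intro measurable_restrict) auto

lemma distr_shift: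
  "finite J \<Longrightarrow> distr M (Pi\<^sub>M J (\<lambda>_. borel)) (\<lambda>\<omega>. \<lambda>t\<in>J. X (t + k) \<omega>) =
     distr M (Pi\<^sub>M J (\<lambda>_. borel)) (\<lambda>\<omega>. \<lambda>t\<in>J. X (t + 0) \<omega>)"
  using stationary by (simp add: strictly_stationary_def)

lemma expectation_shift:
  fixes g :: "real \<Rightarrow> real"
  assumes [measurable]: "g \<in> borel_measurable borel"
  shows "expectation (\<lambda>\<omega>. g (X t \<omega>)) = expectation (\<lambda>\<omega>. g (X 0 \<omega>))"
proof -
  have meas: "(\<lambda>v. g (v 0)) \<in> borel_measurable (Pi\<^sub>M {0::int} (\<lambda>_. borel))" by measurable
  have eq: "(\<integral>v. g (v 0) \<partial>distr M (Pi\<^sub>M {0} (\<lambda>_. borel)) (\<lambda>\<omega>. \<lambda>s\<in>{0}. X (s + k) \<omega>))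
      = expectation (\<lambda>\<omega>. g (X k \<omega>))" for k
    by (subst integral_distr[OF restrict_X_measurable meas]) simp
  show ?thesis using eq[of t] eq[of 0] distr_shift[of "{0}" t] by simp
qed

lemma prob_pair_shift:
  "prob {\<omega>\<in>space M. \<bar>X k \<omega>\<bar> > y \<and> \<bar>X (k + h) \<omega>\<bar> > y} =
   prob {\<omega>\<in>space M. \<bar>X 0 \<omega>\<bar> > y \<and> \<bar>X h \<omega>\<bar> > y}"
proof -
  let ?P = "Pi\<^sub>M {0, h} (\<lambda>_. borel :: real measure)"
  let ?E = "{v\<in>space ?P. \<bar>v 0\<bar> > y \<and> \<bar>v h\<bar> > y}"
  have E: "?E \<in> sets ?P" by measurable
  have eq: "measure (distr M ?P (\<lambda>\<omega>. \<lambda>s\<in>{0, h}. X (s + k) \<omega>)) ?E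
      = prob {\<omega>\<in>space M. \<bar>X k \<omega>\<bar> > y \<and> \<bar>X (k + h) \<omega>\<bar> > y}" for k
    by (subst measure_distr[OF restrict_X_measurable E])
       (auto intro!: arg_cong[where f = prob] simp: space_PiM PiE_def add.commute)
  show ?thesis using eq[of k] eq[of 0] distr_shift[of "{0, h}" k] by simp
qed

lemma prob_shift:
  assumes [measurable]: "Measurable.pred borel P"
  shows "prob {\<omega>\<in>space M. P (X t \<omega>)} = prob {\<omega>\<in>space M. P (X 0 \<omega>)}"
proof -
  have eq: "prob {\<omega>\<in>space M. P (X k \<omega>)} = expectation (\<lambda>\<omega>. indicator {v. P v} (X k \<omega>))" for k
  proof -
    have "{\<omega>\<in>space M. P (X k \<omega>)} \<in> events" by measurable
    then have "prob {\<omega>\<in>space M. P (X k \<omega>)} = expectation (indicator {\<omega>\<in>space M. P (X k \<omega>)})" by simp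
    also have "\<dots> = expectation (\<lambda>\<omega>. indicator {v. P v} (X k \<omega>))"
      by (intro Bochner_Integration.integral_cong) (auto simp: indicator_def)
    finally show ?thesis .
  qed
  have "{v. P v} \<in> sets borel" by measurable
  then show ?thesis unfolding eq by (intro expectation_shift) simp
qed

lemma prob_gt_shift: "prob {\<omega>\<in>space M. X t \<omega> > x} = prob {\<omega>\<in>space M. X 0 \<omega> > x}"
  using prob_shift[of "\<lambda>v. v > x" t] by simp

text \<open>Indices with gaps larger than \<open>m\<close> give independent variables. The product formula follows by
  splitting off the largest index \<open>b\<close>, since all the others lie in the past \<open>{..k}\<close> with
  \<open>k + m < b\<close>.\<close>

lemma expectation_prod_gapped:
  fixes g :: "real \<Rightarrow> real"
  assumes [measurable]: "g \<in> borel_measurable borel" and bounded: "\<And>v. \<bar>g v\<bar> \<le> K"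
    and "finite I" "\<And>i j. i \<in> I \<Longrightarrow> j \<in> I \<Longrightarrow> i < j \<Longrightarrow> i + int m < j"
  shows "expectation (\<lambda>\<omega>. \<Prod>i\<in>I. g (X i \<omega>)) = expectation (\<lambda>\<omega>. g (X 0 \<omega>)) ^ card I"
  using assms(3,4)
proof (induction I rule: finite_linorder_max_induct)
  case empty
  then show ?case by (simp add: prob_space)
next
  case (insert b A)
  define k where "k = b - int m - 1"
  have Ak: "A \<subseteq> {..k}"
  proof
    fix i assume "i \<in> A"
    then have "i + int m < b" using insert by auto
    then show "i \<in> {..k}" by (simp add: k_def)
  qed
  have b: "b \<in> {k + int m<..}" by (simp add: k_def)
  have "indep_var borel ((\<lambda>v. \<Prod>i\<in>A. g (v i)) \<circ> (\<lambda>\<omega>. \<lambda>t\<in>{..k}. X t \<omega>))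
          borel ((\<lambda>v. g (v b)) \<circ> (\<lambda>\<omega>. \<lambda>t\<in>{k + int m<..}. X t \<omega>))"
  proof (rule indep_var_compose)
    show "indep_var (Pi\<^sub>M {..k} (\<lambda>_. borel)) (\<lambda>\<omega>. \<lambda>t\<in>{..k}. X t \<omega>)
            (Pi\<^sub>M {k + int m<..} (\<lambda>_. borel)) (\<lambda>\<omega>. \<lambda>t\<in>{k + int m<..}. X t \<omega>)"
      using dependent by (simp add: m_dependent_def)
    show "(\<lambda>v. \<Prod>i\<in>A. g (v i)) \<in> Pi\<^sub>M {..k} (\<lambda>_. borel) \<rightarrow>\<^sub>M borel"
      using Ak by (intro borel_measurable_prod measurable_compose[OF measurable_component_singleton]) auto
    show "(\<lambda>v. g (v b)) \<in> Pi\<^sub>M {k + int m<..} (\<lambda>_. borel) \<rightarrow>\<^sub>M borel"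
      using b by (intro measurable_compose[OF measurable_component_singleton]) auto
  qed
  also have "(\<lambda>v. \<Prod>i\<in>A. g (v i)) \<circ> (\<lambda>\<omega>. \<lambda>t\<in>{..k}. X t \<omega>) = (\<lambda>\<omega>. \<Prod>i\<in>A. g (X i \<omega>))"
    using Ak by (auto simp: fun_eq_iff intro!: prod.cong)
  also have "(\<lambda>v. g (v b)) \<circ> (\<lambda>\<omega>. \<lambda>t\<in>{k + int m<..}. X t \<omega>) = (\<lambda>\<omega>. g (X b \<omega>))"
    using b by (auto simp: fun_eq_iff)
  finally have indep: "indep_var borel (\<lambda>\<omega>. \<Prod>i\<in>A. g (X i \<omega>)) borel (\<lambda>\<omega>. g (X b \<omega>))" .
  have bA: "b \<notin> A" using insert by auto
  have "expectation (\<lambda>\<omega>. \<Prod>i\<in>insert b A. g (X i \<omega>))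
      = expectation (\<lambda>\<omega>. (\<Prod>i\<in>A. g (X i \<omega>)) * g (X b \<omega>))"
    using insert bA by (simp add: mult.commute)
  also have "\<dots> = expectation (\<lambda>\<omega>. \<Prod>i\<in>A. g (X i \<omega>)) * expectation (\<lambda>\<omega>. g (X b \<omega>))"
  proof (rule indep_var_lebesgue_integral[OF indep])
    show "integrable M (\<lambda>\<omega>. \<Prod>i\<in>A. g (X i \<omega>))"
    proof (rule integrable_const_bound[where B = "\<Prod>i\<in>A. K"], rule AE_I2)
      show "norm (\<Prod>i\<in>A. g (X i \<omega>)) \<le> (\<Prod>i\<in>A. K)" for \<omega>
        unfolding real_norm_def abs_prod by (intro prod_mono) (auto simp: bounded)
    qed measurable
    show "integrable M (\<lambda>\<omega>. g (X b \<omega>))"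
      by (rule integrable_const_bound[where B = K]) (auto simp: bounded)
  qed
  also have "expectation (\<lambda>\<omega>. \<Prod>i\<in>A. g (X i \<omega>)) = expectation (\<lambda>\<omega>. g (X 0 \<omega>)) ^ card A"
    using insert by auto
  also have "expectation (\<lambda>\<omega>. g (X b \<omega>)) = expectation (\<lambda>\<omega>. g (X 0 \<omega>))"
    by (rule expectation_shift) measurable
  finally show ?case using insert bA by (simp add: mult.commute)
qed

lemma prob_pair_far:
  assumes "i + int m < j"
  shows "prob {\<omega>\<in>space M. \<bar>X i \<omega>\<bar> > y \<and> \<bar>X j \<omega>\<bar> > y} = (prob {\<omega>\<in>space M. \<bar>X 0 \<omega>\<bar> > y})\<^sup>2"
proof -
  let ?g = "indicator {v. \<bar>v\<bar> > y} :: real \<Rightarrow> real"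
  have ij: "i \<noteq> j" using assms by auto
  have "expectation (\<lambda>\<omega>. \<Prod>l\<in>{i, j}. ?g (X l \<omega>)) = expectation (\<lambda>\<omega>. ?g (X 0 \<omega>)) ^ card {i, j}"
    using assms by (intro expectation_prod_gapped[where K = 1]) (auto simp: indicator_def)
  moreover have "expectation (\<lambda>\<omega>. \<Prod>l\<in>{i, j}. ?g (X l \<omega>))
      = expectation (indicator {\<omega>\<in>space M. \<bar>X i \<omega>\<bar> > y \<and> \<bar>X j \<omega>\<bar> > y})"
    using ij by (intro Bochner_Integration.integral_cong) (auto simp: indicator_def)
  moreover have "expectation (\<lambda>\<omega>. ?g (X 0 \<omega>)) = expectation (indicator {\<omega>\<in>space M. \<bar>X 0 \<omega>\<bar> > y})"
    by (intro Bochner_Integration.integral_cong) (auto simp: indicator_def)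
  ultimately show ?thesis using ij by (simp add: power2_eq_square)
qed

text \<open>For each \<open>j\<close> at most \<open>m\<close> indices \<open>i < j\<close> are within distance \<open>m\<close>, and these pairs are bounded by \<open>R\<close>; the
  remaining ones are independent.\<close>

lemma sum_prob_pairs_le:
  assumes R: "\<And>h. 1 \<le> h \<Longrightarrow> h \<le> m \<Longrightarrow> prob {\<omega>\<in>space M. \<bar>X 0 \<omega>\<bar> > y \<and> \<bar>X (int h) \<omega>\<bar> > y} \<le> R"
    and "0 \<le> R"
  shows "(\<Sum>j=1..n. \<Sum>i\<in>{1..<j}. prob {\<omega>\<in>space M. \<bar>X (int i) \<omega>\<bar> > y \<and> \<bar>X (int j) \<omega>\<bar> > y})
    \<le> real n * (real m * R + real n * (prob {\<omega>\<in>space M. \<bar>X 0 \<omega>\<bar> > y})\<^sup>2)"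
proof -
  let ?p = "(prob {\<omega>\<in>space M. \<bar>X 0 \<omega>\<bar> > y})\<^sup>2"
  have "(\<Sum>i\<in>{1..<j}. prob {\<omega>\<in>space M. \<bar>X (int i) \<omega>\<bar> > y \<and> \<bar>X (int j) \<omega>\<bar> > y}) \<le> real m * R + real n * ?p"
    if "j \<in> {1..n}" for j
  proof -
    have le: "prob {\<omega>\<in>space M. \<bar>X (int i) \<omega>\<bar> > y \<and> \<bar>X (int j) \<omega>\<bar> > y}
        \<le> (if i \<in> {j - m..<j} then R else 0) + ?p" if i: "i \<in> {1..<j}" for i
    proof (cases "j \<le> i + m")
      case True
      then have "1 \<le> j - i" "j - i \<le> m" using i by auto
      then have "prob {\<omega>\<in>space M. \<bar>X (int i) \<omega>\<bar> > y \<and> \<bar>X (int j) \<omega>\<bar> > y} \<le> R"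
        using R[of "j - i"] prob_pair_shift[of y "int i" "int (j - i)"] i
        by (simp add: of_nat_diff del: One_nat_def)
      moreover have "i \<in> {j - m..<j}" using True i by auto
      moreover have "0 \<le> ?p" by simp
      ultimately show ?thesis by (simp only: if_True)
    next
      case False
      then show ?thesis using prob_pair_far[of "int i" "int j" y] \<open>0 \<le> R\<close> by simp
    qed
    have "(\<Sum>i\<in>{1..<j}. prob {\<omega>\<in>space M. \<bar>X (int i) \<omega>\<bar> > y \<and> \<bar>X (int j) \<omega>\<bar> > y})
        \<le> (\<Sum>i\<in>{1..<j}. (if i \<in> {j - m..<j} then R else 0) + ?p)"
      by (intro sum_mono le)
    also have "\<dots> = (\<Sum>i\<in>{1..<j} \<inter> {j - m..<j}. R) + real (j - 1) * ?p"
      unfolding sum.inter_restrict[OF finite_atLeastLessThan]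
      by (simp only: sum.distrib sum_constant card_atLeastLessThan)
    also have "\<dots> \<le> real m * R + real n * ?p"
    proof (intro add_mono mult_right_mono)
      have "card ({1..<j} \<inter> {j - m..<j}) \<le> card {j - m..<j}" by (intro card_mono) auto
      then have "real (card ({1..<j} \<inter> {j - m..<j})) \<le> real m" by simp
      then show "(\<Sum>i\<in>{1..<j} \<inter> {j - m..<j}. R) \<le> real m * R"
        using \<open>0 \<le> R\<close> by (simp add: mult_right_mono)
    qed (use that in auto)
    finally show ?thesis .
  qed
  then have "(\<Sum>j=1..n. \<Sum>i\<in>{1..<j}. prob {\<omega>\<in>space M. \<bar>X (int i) \<omega>\<bar> > y \<and> \<bar>X (int j) \<omega>\<bar> > y})
    \<le> (\<Sum>j=1..n. real m * R + real n * ?p)" by (rule sum_mono)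
  then show ?thesis by simp
qed

text \<open>If the whole sum exceeds \<open>(m + 1) z\<close>, then one of its \<open>m + 1\<close> residue classes exceeds \<open>z\<close>, and within a class the
  variables are independent. The factor \<open>s\<close> makes both tails available: it will be \<open>1\<close> or \<open>- 1\<close>.\<close>

lemma truncated_sum_chernoff:
  assumes "0 < h" "0 \<le> e" "0 < y"
    and mgf: "expectation (\<lambda>\<omega>. exp (h * (s * trunc y (X 0 \<omega>)))) \<le> exp e"
  shows "prob {\<omega>\<in>space M. (\<Sum>i=1..n. s * trunc y (X (int i) \<omega>)) > real (m + 1) * z}
     \<le> real (m + 1) * exp (real n * e - h * z)"
proof -
  define Y where "Y i \<omega> = s * trunc y (X (int i) \<omega>)" for i \<omega>
  have [measurable]: "Y i \<in> borel_measurable M" for i unfolding Y_def by measurable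
  define I where "I r = {i\<in>{1..n}. i mod (m + 1) = r}" for r
  have finI: "finite (I r)" for r by (simp add: I_def)
  define g where "g v = exp (h * (s * trunc y v))" for v
  have [measurable]: "g \<in> borel_measurable borel" unfolding g_def by measurable
  have gb: "\<bar>g v\<bar> \<le> exp (h * (\<bar>s\<bar> * y))" for v
  proof -
    have "s * trunc y v \<le> \<bar>s\<bar> * \<bar>trunc y v\<bar>" by (metis abs_ge_self abs_mult)
    also have "\<dots> \<le> \<bar>s\<bar> * y" using abs_trunc_le(1)[of y v] assms by (intro mult_left_mono) auto
    finally show ?thesis using assms by (simp add: g_def)
  qed
  have cls: "prob {\<omega>\<in>space M. (\<Sum>i\<in>I r. Y i \<omega>) > z} \<le> exp (real n * e - h * z)" for r
  proof -
    have expsum: "exp (h * (\<Sum>i\<in>I r. Y i \<omega>)) = (\<Prod>i\<in>I r. g (X (int i) \<omega>))" for \<omega>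
      by (simp add: sum_distrib_left exp_sum finI g_def Y_def)
    have prod_int: "(\<Prod>i\<in>I r. g (X (int i) \<omega>)) = (\<Prod>i\<in>int ` I r. g (X i \<omega>))" for \<omega>
      by (simp add: prod.reindex)
    have gap: "i + int m < j" if "i \<in> int ` I r" "j \<in> int ` I r" "i < j" for i j
    proof -
      obtain a b where ab: "i = int a" "j = int b" "a \<in> I r" "b \<in> I r" "a < b"
        using \<open>i \<in> int ` I r\<close> \<open>j \<in> int ` I r\<close> \<open>i < j\<close> by auto
      then have "a mod (m + 1) = b mod (m + 1)" by (simp add: I_def)
      then have "(m + 1) dvd b - a" using ab(5) by (metis mod_eq_dvd_iff_nat less_imp_le)
      then have "m + 1 \<le> b - a" using ab(5) by (intro dvd_imp_le) auto
      then show ?thesis using ab by simp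
    qed
    have "expectation (\<lambda>\<omega>. exp (h * (\<Sum>i\<in>I r. Y i \<omega>))) = expectation (\<lambda>\<omega>. g (X 0 \<omega>)) ^ card (int ` I r)"
      unfolding expsum prod_int
      by (rule expectation_prod_gapped[OF _ gb]) (use finI gap in auto)
    also have "\<dots> \<le> exp e ^ card (int ` I r)"
      using mgf by (intro power_mono) (auto simp: g_def)
    also have "\<dots> = exp (real (card (I r)) * e)" by (simp add: card_image flip: exp_of_nat_mult)
    also have "\<dots> \<le> exp (real n * e)"
    proof -
      have "card (I r) \<le> card {1..n}" by (intro card_mono) (auto simp: I_def)
      then show ?thesis using assms by (simp add: mult_right_mono)
    qed
    finally have E: "expectation (\<lambda>\<omega>. exp (h * (\<Sum>i\<in>I r. Y i \<omega>))) \<le> exp (real n * e)" .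
    have int: "integrable M (\<lambda>\<omega>. exp (h * (\<Sum>i\<in>I r. Y i \<omega>)))"
    proof (rule integrable_const_bound[where B = "\<Prod>i\<in>I r. exp (h * (\<bar>s\<bar> * y))"], rule AE_I2)
      show "norm (exp (h * (\<Sum>i\<in>I r. Y i \<omega>))) \<le> (\<Prod>i\<in>I r. exp (h * (\<bar>s\<bar> * y)))" for \<omega>
        unfolding expsum real_norm_def abs_prod using gb by (intro prod_mono) auto
    qed measurable
    have "prob {\<omega>\<in>space M. (\<Sum>i\<in>I r. Y i \<omega>) > z}
        \<le> prob {\<omega>\<in>space M. exp (h * (\<Sum>i\<in>I r. Y i \<omega>)) \<ge> exp (h * z)}"
      using assms by (intro finite_measure_mono) auto
    also have "\<dots> \<le> expectation (\<lambda>\<omega>. exp (h * (\<Sum>i\<in>I r. Y i \<omega>))) / exp (h * z)"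
      by (rule integral_Markov_inequality_measure[OF int, where A = "{}"]) auto
    also have "\<dots> \<le> exp (real n * e) / exp (h * z)" using E by (simp add: divide_right_mono)
    finally show ?thesis by (simp add: exp_diff)
  qed
  have split: "(\<Sum>i=1..n. Y i \<omega>) = (\<Sum>r\<in>{..m}. \<Sum>i\<in>I r. Y i \<omega>)" for \<omega>
    unfolding I_def by (rule sum.group[symmetric]) (auto simp: less_Suc_eq_le[symmetric])
  have "prob {\<omega>\<in>space M. (\<Sum>i=1..n. Y i \<omega>) > real (m + 1) * z}
      \<le> prob (\<Union>r\<in>{..m}. {\<omega>\<in>space M. (\<Sum>i\<in>I r. Y i \<omega>) > z})"
  proof (intro finite_measure_mono subsetI)
    fix \<omega> assume \<omega>: "\<omega> \<in> {\<omega>\<in>space M. (\<Sum>i=1..n. Y i \<omega>) > real (m + 1) * z}"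
    have "\<exists>r\<in>{..m}. (\<Sum>i\<in>I r. Y i \<omega>) > z"
    proof (rule ccontr)
      assume "\<not> ?thesis"
      then have "(\<Sum>r\<in>{..m}. \<Sum>i\<in>I r. Y i \<omega>) \<le> (\<Sum>r\<in>{..m}. z)"
        by (intro sum_mono) (simp add: not_less)
      then show False using \<omega> split[of \<omega>] by simp
    qed
    then show "\<omega> \<in> (\<Union>r\<in>{..m}. {\<omega>\<in>space M. (\<Sum>i\<in>I r. Y i \<omega>) > z})" using \<omega> by auto
  qed measurable
  also have "\<dots> \<le> (\<Sum>r\<in>{..m}. prob {\<omega>\<in>space M. (\<Sum>i\<in>I r. Y i \<omega>) > z})"
    by (intro finite_measure_subadditive_finite) auto
  also have "\<dots> \<le> (\<Sum>r\<in>{..m}. exp (real n * e - h * z))" by (intro sum_mono cls)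
  finally show ?thesis by (simp add: Y_def)
qed

end

section \<open>One big jump\<close>

lemma sum_eq_trunc_plus_jump:
  assumes one: "\<And>i j. i \<in> {1..n} \<Longrightarrow> j \<in> {1..n} \<Longrightarrow> i < j \<Longrightarrow> \<not> (\<bar>v i\<bar> > y \<and> \<bar>v j\<bar> > y)"
    and j: "j \<in> {1..n::nat}" "\<bar>v j\<bar> > y"
  shows "(\<Sum>i=1..n. v i) = (\<Sum>i=1..n. trunc y (v i)) + v j"
proof -
  have "trunc y (v i) = v i" if "i \<in> {1..n} - {j}" for i
    using one[of i j] one[of j i] that j by (cases i j rule: linorder_cases) (auto simp: trunc_def)
  moreover have "trunc y (v j) = 0" using j by (simp add: trunc_def)
  ultimately show ?thesis using j by (simp add: sum.remove[of _ j])
qed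

context m_dependent_process begin

text \<open>Chernoff's bound with \<open>h = A ln x / x\<close>. The constant \<open>A\<close> is chosen so that \<open>exp (- h z) = x powr - (\<gamma> + 2)\<close> for
  the share \<open>z = c x / (m + 1)\<close> of one residue class. Writing \<open>u = n ln x / x\<^sup>2 \<le> \<kappa>\<close>, the three
  terms of the moment bound contribute at most \<open>1\<close> (drift), \<open>ln x\<close> (variance) and \<open>1\<close> (moment of order \<open>q\<close>). For
  the last one \<open>exp (h \<epsilon> x) = x powr (A \<epsilon>)\<close> must not eat up the gain \<open>x powr (2 - q)\<close>, which
  fixes the threshold \<open>\<epsilon>0 = (q - 2) / (2 A)\<close>. In total the probability is of order
  \<open>x powr (- \<gamma> - 1)\<close>, one power better than the target.\<close>

lemma truncated_sum_negligible:
  assumes int1: "integrable M (X 0)" and mean: "expectation (X 0) = 0"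
    and int2: "integrable M (\<lambda>\<omega>. (X 0 \<omega>)\<^sup>2)"
    and intq: "integrable M (\<lambda>\<omega>. \<bar>X 0 \<omega>\<bar> powr q)" and "2 < q"
    and s: "\<bar>s\<bar> = 1" and "0 < c" "0 < \<gamma>" "0 < c0"
  shows "\<exists>\<epsilon>0>0. \<forall>\<epsilon>. 0 < \<epsilon> \<and> \<epsilon> \<le> \<epsilon>0 \<longrightarrow> (\<exists>\<kappa>>0. \<exists>x0. \<forall>x\<ge>x0. \<forall>n. n * ln x \<le> \<kappa> * x\<^sup>2 \<longrightarrow>
     prob {\<omega>\<in>space M. (\<Sum>i=1..n. s * trunc (\<epsilon> * x) (X (int i) \<omega>)) > c * x} \<le> c0 * x powr - \<gamma>)"
proof -
  define A where "A = (\<gamma> + 2) * real (m + 1) / c"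
  have A: "0 < A" using assms by (simp add: A_def)
  define V where "V = expectation (\<lambda>\<omega>. (X 0 \<omega>)\<^sup>2)"
  define W where "W = expectation (\<lambda>\<omega>. \<bar>X 0 \<omega>\<bar> powr q)"
  have VW: "0 \<le> V" "0 \<le> W" by (auto simp: V_def W_def)
  define d where "d = (q - 2) / 2"
  have d: "0 < d" using \<open>2 < q\<close> by (simp add: d_def)
  define \<epsilon>0 where "\<epsilon>0 = d / A"
  have "\<epsilon>0 > 0" using A d by (simp add: \<epsilon>0_def)
  moreover have "\<exists>\<kappa>>0. \<exists>x0. \<forall>x\<ge>x0. \<forall>n. n * ln x \<le> \<kappa> * x\<^sup>2 \<longrightarrow>
     prob {\<omega>\<in>space M. (\<Sum>i=1..n. s * trunc (\<epsilon> * x) (X (int i) \<omega>)) > c * x} \<le> c0 * x powr - \<gamma>"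
    if \<epsilon>: "0 < \<epsilon>" "\<epsilon> \<le> \<epsilon>0" for \<epsilon>
  proof -
    define \<kappa> where "\<kappa> = min 1 (min (\<epsilon> / (A * V + 1)) (1 / (A\<^sup>2 * V + 1)))"
    have pos: "0 < A * V + 1" "0 < A\<^sup>2 * V + 1" using A VW by (simp_all add: add_nonneg_pos)
    have \<kappa>1: "0 < \<kappa>" "\<kappa> \<le> 1" "\<kappa> \<le> \<epsilon> / (A * V + 1)" "\<kappa> \<le> 1 / (A\<^sup>2 * V + 1)"
      using \<epsilon> pos by (simp_all add: \<kappa>_def)
    have \<kappa>: "0 < \<kappa>" "\<kappa> \<le> 1" "\<kappa> * (A * V + 1) \<le> \<epsilon>" "\<kappa> * (A\<^sup>2 * V + 1) \<le> 1"
      using \<kappa>1 unfolding le_divide_eq[of \<kappa>] using pos by simp_all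
    have lim: "((\<lambda>x. W * A powr q * (x powr - d * ln x powr (q - 1))) \<longlongrightarrow> 0) at_top"
    proof -
      have "((\<lambda>x. x powr - d * ln x powr (q - 1)) \<longlongrightarrow> 0) at_top"
        using d \<open>2 < q\<close> by real_asymp
      from tendsto_mult_right_zero[OF this] show ?thesis by simp
    qed
    then have "eventually (\<lambda>x. W * A powr q * (x powr - d * ln x powr (q - 1)) < 1) at_top"
      by (rule order_tendstoD) simp
    then obtain x1 where x1: "\<And>x. x \<ge> x1 \<Longrightarrow> W * A powr q * (x powr - d * ln x powr (q - 1)) < 1"
      by (auto simp: eventually_at_top_linorder)
    define x0 where "x0 = max (exp 1) (max x1 (real (m + 1) * exp 2 / c0))"
    have "prob {\<omega>\<in>space M. (\<Sum>i=1..n. s * trunc (\<epsilon> * x) (X (int i) \<omega>)) > c * x} \<le> c0 * x powr - \<gamma>"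
      if x: "x \<ge> x0" and n: "real n * ln x \<le> \<kappa> * x\<^sup>2" for x n
    proof -
      have x': "x \<ge> exp 1" "x \<ge> x1" "x \<ge> real (m + 1) * exp 2 / c0" using x by (auto simp: x0_def)
      have x_pos: "0 < x" using x'(1) exp_gt_zero[of "1::real"] by linarith
      have lnx: "1 \<le> ln x" using x'(1) x_pos by (simp add: ln_ge_iff)
      define h where "h = A * ln x / x"
      define y where "y = \<epsilon> * x"
      define e where "e = h * V / y + h\<^sup>2 * V + exp (h * y) * h powr q * W"
      have "0 < ln x" using lnx by linarith
      then have h: "0 < h" and y: "0 < y" using A lnx x_pos \<epsilon> by (simp_all add: h_def y_def)
      have e0: "0 \<le> e" using h y VW by (simp add: e_def)
      have s2: "s\<^sup>2 = 1" using s by (metis power2_abs one_power2)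
      have "expectation (\<lambda>\<omega>. exp (h * trunc y (s * X 0 \<omega>)))
          \<le> exp (h * expectation (\<lambda>\<omega>. (s * X 0 \<omega>)\<^sup>2) / y + h\<^sup>2 * expectation (\<lambda>\<omega>. (s * X 0 \<omega>)\<^sup>2)
             + exp (h * y) * h powr q * expectation (\<lambda>\<omega>. \<bar>s * X 0 \<omega>\<bar> powr q))"
        using int1 int2 intq mean h y \<open>2 < q\<close> s
        by (intro mgf_trunc_le) (auto simp: power_mult_distrib abs_mult)
      then have "expectation (\<lambda>\<omega>. exp (h * trunc y (s * X 0 \<omega>))) \<le> exp e"
        by (simp add: power_mult_distrib abs_mult s s2 e_def V_def W_def)
      moreover have "trunc y (s * v) = s * trunc y v" for v
        using s by (simp add: trunc_def abs_mult)
      ultimately have mgf: "expectation (\<lambda>\<omega>. exp (h * (s * trunc y (X 0 \<omega>)))) \<le> exp e" by simp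
      define u where "u = real n * ln x / x\<^sup>2"
      have u: "0 \<le> u" "u \<le> \<kappa>"
        using n \<open>0 < ln x\<close> x_pos by (simp_all add: u_def divide_le_eq)
      have "real n * (h * V / y) = A * V * u / \<epsilon>"
        using x_pos \<epsilon> by (simp add: h_def y_def u_def field_simps power2_eq_square)
      also have "\<dots> \<le> 1"
      proof -
        have "A * V * u \<le> (A * V + 1) * \<kappa>" using u pos A VW by (intro mult_mono) auto
        then show ?thesis using \<kappa>(3) \<epsilon> by (simp add: mult.commute)
      qed
      finally have t1: "real n * (h * V / y) \<le> 1" .
      have "real n * (h\<^sup>2 * V) = (A\<^sup>2 * V * u) * ln x"
        using x_pos by (simp add: h_def u_def field_simps power2_eq_square)
      also have "\<dots> \<le> 1 * ln x"
      proof (intro mult_right_mono)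
        have "A\<^sup>2 * V * u \<le> (A\<^sup>2 * V + 1) * \<kappa>" using u pos A VW by (intro mult_mono) auto
        then show "A\<^sup>2 * V * u \<le> 1" using \<kappa>(4) by (simp add: mult.commute)
      qed (use lnx in simp)
      finally have t2: "real n * (h\<^sup>2 * V) \<le> ln x" by simp
      have ehy: "exp (h * y) \<le> x powr d"
      proof -
        have "h * y = A * \<epsilon> * ln x" using x_pos by (simp add: h_def y_def)
        also have "\<dots> \<le> d * ln x"
          using \<epsilon> A lnx by (intro mult_right_mono) (auto simp: \<epsilon>0_def field_simps)
        finally show ?thesis using x_pos by (simp add: powr_def)
      qed
      have hq: "h powr q = A powr q * ln x powr q * x powr - q"
        using A lnx x_pos by (simp add: h_def powr_mult powr_divide powr_minus_divide)
      have "real n * (exp (h * y) * h powr q * W) = u * (x\<^sup>2 / ln x) * (exp (h * y) * h powr q * W)"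
        using \<open>0 < ln x\<close> x_pos by (simp add: u_def)
      also have "\<dots> \<le> 1 * (x\<^sup>2 / ln x) * (x powr d * h powr q * W)"
        using u \<kappa> lnx VW ehy by (intro mult_mono) auto
      also have "\<dots> = W * A powr q * (x powr - d * ln x powr (q - 1))"
      proof -
        have "x powr 2 * x powr d * x powr - q = x powr - d"
        proof -
          have "2 + d + - q = - d" by (simp add: d_def field_simps)
          moreover have "x powr 2 * x powr d * x powr - q = x powr (2 + d + - q)"
            by (simp only: powr_add)
          ultimately show ?thesis by (simp only:)
        qed
        moreover have "ln x powr q / ln x = ln x powr (q - 1)"
          using lnx by (simp add: powr_diff)
        moreover have "1 * (x\<^sup>2 / ln x) * (x powr d * h powr q * W)
            = W * A powr q * ((x powr 2 * x powr d * x powr - q) * (ln x powr q / ln x))"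
          unfolding hq using x_pos by (simp add: mult_ac)
        ultimately show ?thesis by (simp only:)
      qed
      also have "\<dots> \<le> 1" using x1[OF x'(2)] by simp
      finally have t3: "real n * (exp (h * y) * h powr q * W) \<le> 1" .
      have ne: "real n * e \<le> 2 + ln x" using t1 t2 t3 by (simp add: e_def distrib_left)
      define z where "z = c * x / real (m + 1)"
      have hz: "h * z = (\<gamma> + 2) * ln x"
      proof -
        have "(\<gamma> + 2) * k / c * ln x / x * (c * x / k) = (\<gamma> + 2) * ln x" if "k \<noteq> 0" for k
          using that \<open>0 < c\<close> x_pos by simp
        then show ?thesis unfolding h_def z_def A_def by simp
      qed
      have "prob {\<omega>\<in>space M. (\<Sum>i=1..n. s * trunc y (X (int i) \<omega>)) > real (m + 1) * z}
         \<le> real (m + 1) * exp (real n * e - h * z)"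
        by (rule truncated_sum_chernoff[OF h e0 y mgf])
      also have "\<dots> \<le> real (m + 1) * exp (2 + ln x - (\<gamma> + 2) * ln x)"
        using ne hz by (intro mult_left_mono) auto
      also have "\<dots> = real (m + 1) * exp 2 * (x powr - \<gamma> / x)"
        using x_pos by (simp add: powr_def exp_diff exp_add exp_minus algebra_simps divide_simps)
      also have "\<dots> \<le> c0 * x powr - \<gamma>"
      proof -
        have "real (m + 1) * exp 2 / x \<le> c0" using x'(3) \<open>0 < c0\<close> x_pos by (simp add: field_simps)
        then have "real (m + 1) * exp 2 / x * x powr - \<gamma> \<le> c0 * x powr - \<gamma>" by (rule mult_right_mono) simp
        then show ?thesis by simp
      qed
      finally show ?thesis by (simp add: z_def y_def)
    qed
    then show ?thesis using \<kappa>(1) by blast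
  qed
  ultimately show ?thesis by blast
qed

definition pair_sum :: "nat \<Rightarrow> real \<Rightarrow> real" where
  "pair_sum n y = (\<Sum>j=1..n. \<Sum>i\<in>{1..<j}. prob {\<omega>\<in>space M. \<bar>X (int i) \<omega>\<bar> > y \<and> \<bar>X (int j) \<omega>\<bar> > y})"

lemma prob_two_jumps_le:
  "prob (\<Union>j\<in>{1..n}. \<Union>i\<in>{1..<j}. {\<omega>\<in>space M. \<bar>X (int i) \<omega>\<bar> > y \<and> \<bar>X (int j) \<omega>\<bar> > y}) \<le> pair_sum n y"
  unfolding pair_sum_def
  by (rule order_trans[OF finite_measure_subadditive_finite sum_mono[OF finite_measure_subadditive_finite]]) auto

text \<open>If the truncated sum is at most \<open>\<delta> x\<close> and at most one summand is truncated, then a value of the sum above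
  \<open>x\<close> forces that summand above \<open>(1 - \<delta>) x\<close>.\<close>

lemma prob_sum_gt_le:
  assumes "0 < x" "0 < \<delta>" "\<delta> < 1"
  shows "prob {\<omega>\<in>space M. (\<Sum>i=1..n. X (int i) \<omega>) > x}
    \<le> prob {\<omega>\<in>space M. (\<Sum>i=1..n. trunc y (X (int i) \<omega>)) > \<delta> * x}
      + real n * prob {\<omega>\<in>space M. X 0 \<omega> > (1 - \<delta>) * x} + pair_sum n y"
proof -
  let ?S = "{\<omega>\<in>space M. (\<Sum>i=1..n. X (int i) \<omega>) > x}"
  let ?T = "{\<omega>\<in>space M. (\<Sum>i=1..n. trunc y (X (int i) \<omega>)) > \<delta> * x}"
  let ?J = "\<Union>j\<in>{1..n}. {\<omega>\<in>space M. X (int j) \<omega> > (1 - \<delta>) * x}"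
  let ?P = "\<Union>j\<in>{1..n}. \<Union>i\<in>{1..<j}. {\<omega>\<in>space M. \<bar>X (int i) \<omega>\<bar> > y \<and> \<bar>X (int j) \<omega>\<bar> > y}"
  have sub: "?S \<subseteq> ?T \<union> ?J \<union> ?P"
  proof
    fix \<omega> assume \<omega>: "\<omega> \<in> ?S"
    show "\<omega> \<in> ?T \<union> ?J \<union> ?P"
    proof (rule ccontr)
      assume not: "\<omega> \<notin> ?T \<union> ?J \<union> ?P"
      have one: "\<not> (\<bar>X (int i) \<omega>\<bar> > y \<and> \<bar>X (int j) \<omega>\<bar> > y)"
        if "i \<in> {1..n}" "j \<in> {1..n}" "i < j" for i j
      proof -
        have "i \<in> {1..<j}" using that by simp
        then show ?thesis using not \<omega> that(2) by blast
      qed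
      have T: "(\<Sum>i=1..n. trunc y (X (int i) \<omega>)) \<le> \<delta> * x" using not \<omega> by auto
      show False
      proof (cases "\<exists>j\<in>{1..n}. \<bar>X (int j) \<omega>\<bar> > y")
        case True
        then obtain j where j: "j \<in> {1..n}" "\<bar>X (int j) \<omega>\<bar> > y" by blast
        have "(\<Sum>i=1..n. X (int i) \<omega>) = (\<Sum>i=1..n. trunc y (X (int i) \<omega>)) + X (int j) \<omega>"
          using sum_eq_trunc_plus_jump[where v = "\<lambda>i. X (int i) \<omega>" and n = n and y = y and j = j] one j by blast
        moreover have "X (int j) \<omega> \<le> (1 - \<delta>) * x" using not \<omega> j by (auto simp: not_less)
        ultimately show False using T \<omega> by (simp add: algebra_simps)
      next
        case False
        then have "(\<Sum>i=1..n. X (int i) \<omega>) = (\<Sum>i=1..n. trunc y (X (int i) \<omega>))"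
          by (intro sum.cong) (auto simp: trunc_def not_less)
        moreover have "\<delta> * x < x" using assms by simp
        ultimately show False using T \<omega> by auto
      qed
    qed
  qed
  have meas[measurable]: "?J \<in> events" "?P \<in> events" by (auto intro!: sets.finite_UN)
  have "prob ?S \<le> prob (?T \<union> ?J \<union> ?P)" by (rule finite_measure_mono[OF sub]) measurable
  also have "\<dots> \<le> prob ?T + prob ?J + prob ?P"
    by (rule order_trans[OF measure_Un_le add_right_mono[OF measure_Un_le]]) measurable
  also have "prob ?J \<le> (\<Sum>j=1..n. prob {\<omega>\<in>space M. X (int j) \<omega> > (1 - \<delta>) * x})"
    by (intro finite_measure_subadditive_finite) auto
  also have "\<dots> = real n * prob {\<omega>\<in>space M. X 0 \<omega> > (1 - \<delta>) * x}"
    by (subst sum.cong[OF refl prob_gt_shift]) simp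
  also have "prob ?P \<le> pair_sum n y" by (rule prob_two_jumps_le)
  finally show ?thesis by simp
qed

text \<open>Conversely a summand above \<open>(1 + \<delta>) x\<close> pushes the sum above \<open>x\<close> unless the truncated rest falls below
  \<open>- \<delta> x\<close> or a second summand is large. The pair sum appears twice: once as this exceptional event, once
  in Bonferroni's inequality for the union of the jump events.\<close>

lemma prob_sum_gt_ge:
  assumes "0 < x" "0 < \<delta>" "y \<le> x"
  shows "real n * prob {\<omega>\<in>space M. X 0 \<omega> > (1 + \<delta>) * x} - 2 * pair_sum n y
      - prob {\<omega>\<in>space M. (\<Sum>i=1..n. - trunc y (X (int i) \<omega>)) > \<delta> * x}
    \<le> prob {\<omega>\<in>space M. (\<Sum>i=1..n. X (int i) \<omega>) > x}"
proof -
  let ?S = "{\<omega>\<in>space M. (\<Sum>i=1..n. X (int i) \<omega>) > x}"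
  let ?T = "{\<omega>\<in>space M. (\<Sum>i=1..n. - trunc y (X (int i) \<omega>)) > \<delta> * x}"
  define A where "A j = {\<omega>\<in>space M. X (int j) \<omega> > (1 + \<delta>) * x}" for j
  let ?J = "\<Union>j\<in>{1..n}. A j"
  let ?P = "\<Union>j\<in>{1..n}. \<Union>i\<in>{1..<j}. {\<omega>\<in>space M. \<bar>X (int i) \<omega>\<bar> > y \<and> \<bar>X (int j) \<omega>\<bar> > y}"
  have A [measurable]: "A j \<in> events" for j unfolding A_def by measurable
  have "x \<le> (1 + \<delta>) * x" using assms by simp
  then have big: "\<bar>X (int j) \<omega>\<bar> > y" if "\<omega> \<in> A j" for j \<omega>
    using that assms unfolding A_def by (smt (verit) mem_Collect_eq)
  have sub: "?J \<subseteq> ?S \<union> ?T \<union> ?P"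
  proof
    fix \<omega> assume "\<omega> \<in> ?J"
    then obtain j where j: "j \<in> {1..n}" "\<omega> \<in> A j" by blast
    then have \<omega>: "\<omega> \<in> space M" by (simp add: A_def)
    show "\<omega> \<in> ?S \<union> ?T \<union> ?P"
    proof (rule ccontr)
      assume not: "\<omega> \<notin> ?S \<union> ?T \<union> ?P"
      have one: "\<not> (\<bar>X (int i) \<omega>\<bar> > y \<and> \<bar>X (int j) \<omega>\<bar> > y)"
        if "i \<in> {1..n}" "j \<in> {1..n}" "i < j" for i j
      proof -
        have "i \<in> {1..<j}" using that by simp
        then show ?thesis using not \<omega> that(2) by blast
      qed
      have "(\<Sum>i=1..n. X (int i) \<omega>) = (\<Sum>i=1..n. trunc y (X (int i) \<omega>)) + X (int j) \<omega>"
        using sum_eq_trunc_plus_jump[where v = "\<lambda>i. X (int i) \<omega>" and n = n and y = y and j = j] one j big by blast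
      moreover have "(\<Sum>i=1..n. X (int i) \<omega>) \<le> x" "- (\<Sum>i=1..n. trunc y (X (int i) \<omega>)) \<le> \<delta> * x"
        using not \<omega> by (auto simp: sum_negf)
      moreover have "X (int j) \<omega> > (1 + \<delta>) * x" using j by (simp add: A_def)
      ultimately show False by (simp add: algebra_simps)
    qed
  qed
  have meas[measurable]: "?J \<in> events" "?P \<in> events" by (auto intro!: sets.finite_UN)
  have "(\<Sum>j=1..n. \<Sum>i\<in>{1..<j}. prob (A i \<inter> A j)) \<le> pair_sum n y"
    unfolding pair_sum_def using big
    by (intro sum_mono finite_measure_mono) (auto simp: A_def)
  moreover have "(\<Sum>j=1..n. prob (A j)) = real n * prob {\<omega>\<in>space M. X 0 \<omega> > (1 + \<delta>) * x}"
    unfolding A_def by (subst sum.cong[OF refl prob_gt_shift]) simp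
  moreover note prob_UN_ge_bonferroni[of A n, OF A]
  moreover have "prob ?J \<le> prob (?S \<union> ?T \<union> ?P)" by (rule finite_measure_mono[OF sub]) measurable
  moreover have "\<dots> \<le> prob ?S + prob ?T + prob ?P"
    by (rule order_trans[OF measure_Un_le add_right_mono[OF measure_Un_le]]) measurable
  moreover note prob_two_jumps_le[of y n]
  ultimately show ?thesis by linarith
qed

text \<open>The error budget. Choose \<open>\<delta>\<close> so that \<open>(1 \<plusminus> \<delta>) powr - \<alpha>\<close> is within \<open>\<eta> / 4\<close> of 1, then
  \<open>\<epsilon>\<close> so small that both tails of the truncated sum cost at most \<open>n G(x) \<eta> / 8\<close>. The pair sum costs at
  most \<open>n G(x) \<eta> / 8\<close> as well: \<open>P(\<bar>X\<bar> > \<epsilon> x) \<le> D G(x)\<close>, and per index the close pairs and the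
  distant pairs contribute factors \<open>m r\<close> and \<open>n P(\<bar>X\<bar> > \<epsilon> x)\<close>, each at most
  \<open>\<eta> / (16 D)\<close>.\<close>

lemma big_jump_uniform:
  defines "G \<equiv> \<lambda>x. prob {\<omega>\<in>space M. X 0 \<omega> > x}"
    and "p \<equiv> \<lambda>x. prob {\<omega>\<in>space M. \<bar>X 0 \<omega>\<bar> > x}"
  assumes int1: "integrable M (X 0)" and mean: "expectation (X 0) = 0"
    and int2: "integrable M (\<lambda>\<omega>. (X 0 \<omega>)\<^sup>2)"
    and intq: "integrable M (\<lambda>\<omega>. \<bar>X 0 \<omega>\<bar> powr q)" and "2 < q"
    and ratio: "\<And>c. 0 < c \<Longrightarrow> ((\<lambda>x. G (c * x) / G x) \<longlongrightarrow> c powr - \<alpha>) at_top"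
    and Gpos: "\<And>x. a \<le> x \<Longrightarrow> 0 < G x"
    and pG: "eventually (\<lambda>x. p x \<le> C * G x) at_top" and "0 < C"
    and anti_cluster: "\<And>h::nat. 1 \<le> h \<Longrightarrow> h \<le> m \<Longrightarrow>
        ((\<lambda>x. prob {\<omega>\<in>space M. \<bar>X 0 \<omega>\<bar> > x \<and> \<bar>X (int h) \<omega>\<bar> > x} / p x) \<longlongrightarrow> 0) at_top"
    and "0 < \<eta>"
  shows "\<exists>\<kappa>>0. \<exists>x0. \<forall>x\<ge>x0. \<forall>n\<ge>1. real n * ln x \<le> \<kappa> * x\<^sup>2 \<longrightarrow>
     \<bar>prob {\<omega>\<in>space M. (\<Sum>i=1..n. X (int i) \<omega>) > x} / (real n * G x) - 1\<bar> \<le> \<eta>"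
proof -
  have anti: "G y \<le> G x" if "x \<le> y" for x y
    unfolding G_def using that by (intro finite_measure_mono) auto
  have Gle: "G x \<le> p x" for x
    unfolding G_def p_def by (intro finite_measure_mono) auto
  define V where "V = expectation (\<lambda>\<omega>. (X 0 \<omega>)\<^sup>2)"
  have V: "0 \<le> V" by (simp add: V_def)
  have "((\<lambda>\<delta>. (1 - \<delta>) powr - \<alpha>) \<longlongrightarrow> (1 - 0) powr - \<alpha>) (at_right 0)"
    "((\<lambda>\<delta>. (1 + \<delta>) powr - \<alpha>) \<longlongrightarrow> (1 + 0) powr - \<alpha>) (at_right 0)"
    by (intro tendsto_intros; simp)+
  then have "eventually (\<lambda>\<delta>. (1 - \<delta>) powr - \<alpha> < 1 + \<eta> / 4) (at_right 0)"
    "eventually (\<lambda>\<delta>. 1 - \<eta> / 4 < (1 + \<delta>) powr - \<alpha>) (at_right 0)"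
    using \<open>0 < \<eta>\<close> by (auto elim!: order_tendstoD)
  moreover have "eventually (\<lambda>\<delta>::real. 0 < \<delta> \<and> \<delta> < 1) (at_right 0)"
    by (rule eventually_at_rightI[of 0 1]) auto
  ultimately have "eventually (\<lambda>\<delta>. (1 - \<delta>) powr - \<alpha> < 1 + \<eta> / 4 \<and> 1 - \<eta> / 4 < (1 + \<delta>) powr - \<alpha>
      \<and> 0 < \<delta> \<and> \<delta> < 1) (at_right (0::real))"
    by eventually_elim auto
  then obtain \<delta> where \<delta>: "(1 - \<delta>) powr - \<alpha> < 1 + \<eta> / 4" "1 - \<eta> / 4 < (1 + \<delta>) powr - \<alpha>" "0 < \<delta>" "\<delta> < 1"
    by (metis (no_types, lifting) eventually_happens trivial_limit_at_right_real)
  obtain \<gamma> c0 x1 where low: "0 < \<gamma>" "0 < c0" "\<And>x. x1 \<le> x \<Longrightarrow> c0 * x powr - \<gamma> \<le> G x"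
    using dyadic_lower_bound[of G a "2 powr - \<alpha>", OF anti Gpos ratio[of 2]] by auto
  have c1: "0 < \<eta> / 8 * c0" using \<open>0 < \<eta>\<close> low by simp
  obtain e1 where e1: "0 < e1" "\<And>\<epsilon>. 0 < \<epsilon> \<Longrightarrow> \<epsilon> \<le> e1 \<Longrightarrow> \<exists>\<kappa>>0. \<exists>x0. \<forall>x\<ge>x0. \<forall>n. real n * ln x \<le> \<kappa> * x\<^sup>2 \<longrightarrow>
     prob {\<omega>\<in>space M. (\<Sum>i=1..n. 1 * trunc (\<epsilon> * x) (X (int i) \<omega>)) > \<delta> * x} \<le> \<eta> / 8 * c0 * x powr - \<gamma>"
    using truncated_sum_negligible[OF int1 mean int2 intq \<open>2 < q\<close> _ \<delta>(3) low(1) c1, of 1] by auto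
  obtain e2 where e2: "0 < e2" "\<And>\<epsilon>. 0 < \<epsilon> \<Longrightarrow> \<epsilon> \<le> e2 \<Longrightarrow> \<exists>\<kappa>>0. \<exists>x0. \<forall>x\<ge>x0. \<forall>n. real n * ln x \<le> \<kappa> * x\<^sup>2 \<longrightarrow>
     prob {\<omega>\<in>space M. (\<Sum>i=1..n. - 1 * trunc (\<epsilon> * x) (X (int i) \<omega>)) > \<delta> * x} \<le> \<eta> / 8 * c0 * x powr - \<gamma>"
    using truncated_sum_negligible[OF int1 mean int2 intq \<open>2 < q\<close> _ \<delta>(3) low(1) c1, of "- 1"] by auto
  define \<epsilon> where "\<epsilon> = min 1 (min e1 e2)"
  have \<epsilon>: "0 < \<epsilon>" "\<epsilon> \<le> 1" "\<epsilon> \<le> e1" "\<epsilon> \<le> e2" using e1 e2 by (auto simp: \<epsilon>_def)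
  obtain \<kappa>1 x2 where T1: "0 < \<kappa>1" "\<And>x n. x2 \<le> x \<Longrightarrow> real n * ln x \<le> \<kappa>1 * x\<^sup>2 \<Longrightarrow>
     prob {\<omega>\<in>space M. (\<Sum>i=1..n. trunc (\<epsilon> * x) (X (int i) \<omega>)) > \<delta> * x} \<le> \<eta> / 8 * c0 * x powr - \<gamma>"
    using e1(2)[OF \<epsilon>(1,3)] by auto
  obtain \<kappa>2 x3 where T2: "0 < \<kappa>2" "\<And>x n. x3 \<le> x \<Longrightarrow> real n * ln x \<le> \<kappa>2 * x\<^sup>2 \<Longrightarrow>
     prob {\<omega>\<in>space M. (\<Sum>i=1..n. - trunc (\<epsilon> * x) (X (int i) \<omega>)) > \<delta> * x} \<le> \<eta> / 8 * c0 * x powr - \<gamma>"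
    using e2(2)[OF \<epsilon>(1,4)] by auto
  define D where "D = C * (\<epsilon> powr - \<alpha> + 1)"
  have D: "0 < D" using \<open>0 < C\<close> by (simp add: D_def add_nonneg_pos)
  define r where "r = \<eta> / (16 * (real m + 1) * D)"
  have r: "0 < r" using \<open>0 < \<eta>\<close> D by (simp add: r_def)
  define \<kappa> where "\<kappa> = min (min \<kappa>1 \<kappa>2) (\<eta> * \<epsilon>\<^sup>2 / (16 * D * (V + 1)))"
  have \<kappa>: "0 < \<kappa>" "\<kappa> \<le> \<kappa>1" "\<kappa> \<le> \<kappa>2" "\<kappa> \<le> \<eta> * \<epsilon>\<^sup>2 / (16 * D * (V + 1))"
    using T1 T2 \<open>0 < \<eta>\<close> \<epsilon> D V by (auto simp: \<kappa>_def)
  have scale: "filterlim (\<lambda>x. \<epsilon> * x) at_top at_top"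
    using \<epsilon> by (intro filterlim_tendsto_pos_mult_at_top[OF tendsto_const] filterlim_ident)
  have E1: "eventually (\<lambda>x. G ((1 - \<delta>) * x) / G x < 1 + \<eta> / 4) at_top"
    using ratio[of "1 - \<delta>"] \<delta> by (auto elim!: order_tendstoD)
  have E2: "eventually (\<lambda>x. 1 - \<eta> / 4 < G ((1 + \<delta>) * x) / G x) at_top"
    using ratio[of "1 + \<delta>"] \<delta> by (auto elim!: order_tendstoD)
  have E3: "eventually (\<lambda>x. G (\<epsilon> * x) / G x < \<epsilon> powr - \<alpha> + 1) at_top"
    using ratio[OF \<epsilon>(1)] by (rule order_tendstoD) simp
  have E4: "eventually (\<lambda>x. p (\<epsilon> * x) \<le> C * G (\<epsilon> * x)) at_top"
    using pG scale by (rule eventually_compose_filterlim)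
  have "eventually (\<lambda>x. \<forall>h\<in>{1..m}. prob {\<omega>\<in>space M. \<bar>X 0 \<omega>\<bar> > x \<and> \<bar>X (int h) \<omega>\<bar> > x} / p x < r) at_top"
    using order_tendstoD(2)[OF anti_cluster r] by (intro eventually_ball_finite) auto
  then have E5: "eventually (\<lambda>x. \<forall>h\<in>{1..m}.
      prob {\<omega>\<in>space M. \<bar>X 0 \<omega>\<bar> > \<epsilon> * x \<and> \<bar>X (int h) \<omega>\<bar> > \<epsilon> * x} / p (\<epsilon> * x) < r) at_top"
    using scale by (rule eventually_compose_filterlim)
  have E6: "eventually (\<lambda>x::real. x \<ge> exp 1 \<and> x \<ge> x1 \<and> x \<ge> x2 \<and> x \<ge> x3 \<and> x \<ge> a \<and> x \<ge> a / \<epsilon>) at_top"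
    by (intro eventually_conj eventually_ge_at_top)
  have "eventually (\<lambda>x. \<forall>n\<ge>1. real n * ln x \<le> \<kappa> * x\<^sup>2 \<longrightarrow>
     \<bar>prob {\<omega>\<in>space M. (\<Sum>i=1..n. X (int i) \<omega>) > x} / (real n * G x) - 1\<bar> \<le> \<eta>) at_top"
    using E1 E2 E3 E4 E5 E6
  proof (eventually_elim, intro allI impI)
    fix x n
    assume elim: "G ((1 - \<delta>) * x) / G x < 1 + \<eta> / 4" "1 - \<eta> / 4 < G ((1 + \<delta>) * x) / G x"
      "G (\<epsilon> * x) / G x < \<epsilon> powr - \<alpha> + 1" "p (\<epsilon> * x) \<le> C * G (\<epsilon> * x)"
      "\<forall>h\<in>{1..m}. prob {\<omega>\<in>space M. \<bar>X 0 \<omega>\<bar> > \<epsilon> * x \<and> \<bar>X (int h) \<omega>\<bar> > \<epsilon> * x} / p (\<epsilon> * x) < r"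
      "exp 1 \<le> x \<and> x1 \<le> x \<and> x2 \<le> x \<and> x3 \<le> x \<and> a \<le> x \<and> a / \<epsilon> \<le> x"
      "1 \<le> n" "real n * ln x \<le> \<kappa> * x\<^sup>2"
    have x_pos: "0 < x" using elim(6) exp_gt_zero[of "1::real"] by linarith
    have lnx: "1 \<le> ln x" using elim(6) x_pos by (simp add: ln_ge_iff)
    have Gx: "0 < G x" using Gpos elim by simp
    have n: "1 \<le> real n" using elim by simp
    define y where "y = \<epsilon> * x"
    have y: "0 < y" "y \<le> x" using \<epsilon> x_pos by (auto simp: y_def mult_left_le_one_le)
    have "a \<le> y" using elim(6) \<epsilon> by (simp add: y_def field_simps)
    then have py_pos: "0 < p y" using Gpos[of y] Gle[of y] by linarith
    have py: "p y \<le> D * G x"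
    proof -
      have "G y \<le> (\<epsilon> powr - \<alpha> + 1) * G x" using elim(3) Gx by (simp add: y_def field_simps)
      then have "C * G y \<le> D * G x" using \<open>0 < C\<close> by (simp add: D_def mult.assoc)
      then show ?thesis using elim(4) by (simp add: y_def)
    qed
    have chebyshev: "p y * y\<^sup>2 \<le> V"
    proof -
      have "p y \<le> prob {\<omega>\<in>space M. (X 0 \<omega>)\<^sup>2 \<ge> y\<^sup>2}"
        unfolding p_def
      proof (intro finite_measure_mono subsetI)
        fix \<omega> assume "\<omega> \<in> {\<omega> \<in> space M. y < \<bar>X 0 \<omega>\<bar>}"
        then show "\<omega> \<in> {\<omega>\<in>space M. (X 0 \<omega>)\<^sup>2 \<ge> y\<^sup>2}"
          using y by (auto simp: abs_le_square_iff[symmetric])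
      qed measurable
      also have "\<dots> \<le> V / y\<^sup>2"
        unfolding V_def using y by (intro integral_Markov_inequality_measure[OF int2, where A = "{}"]) auto
      finally show ?thesis using y by (simp add: field_simps)
    qed
    have np: "real n * p y \<le> \<eta> / (16 * D)"
    proof -
      have "real n * 1 \<le> real n * ln x" using lnx by (intro mult_left_mono) auto
      then have nx: "real n \<le> \<kappa> * x\<^sup>2" using elim(8) by simp
      have "real n * p y * \<epsilon>\<^sup>2 \<le> \<kappa> * x\<^sup>2 * p y * \<epsilon>\<^sup>2"
        using nx py_pos by (intro mult_right_mono) auto
      also have "\<dots> = \<kappa> * (p y * y\<^sup>2)" by (simp add: y_def power_mult_distrib)
      also have "\<dots> \<le> \<kappa> * (V + 1)" using chebyshev \<kappa> by (intro mult_left_mono) auto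
      also have "\<dots> \<le> \<eta> * \<epsilon>\<^sup>2 / (16 * D * (V + 1)) * (V + 1)"
        using \<kappa>(4) V by (intro mult_right_mono) auto
      also have "\<dots> = \<eta> / (16 * D) * \<epsilon>\<^sup>2" using V by simp
      finally show ?thesis by (rule mult_right_le_imp_le) (use \<epsilon> in simp)
    qed
    have pairs: "pair_sum n y \<le> real n * G x * (\<eta> / 8)"
    proof -
      have near: "prob {\<omega>\<in>space M. \<bar>X 0 \<omega>\<bar> > y \<and> \<bar>X (int h) \<omega>\<bar> > y} \<le> r * p y"
        if "1 \<le> h" "h \<le> m" for h
        using elim(5) that py_pos by (force simp: y_def field_simps)
      have "pair_sum n y \<le> real n * (real m * (r * p y) + real n * (p y)\<^sup>2)"
        unfolding pair_sum_def p_def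
        by (rule sum_prob_pairs_le) (use near r in \<open>auto simp: p_def\<close>)
      also have "\<dots> = real n * (p y * (real m * r + real n * p y))"
        by (simp add: power2_eq_square algebra_simps)
      also have "\<dots> \<le> real n * (D * G x * (\<eta> / (16 * D) + \<eta> / (16 * D)))"
      proof (intro mult_left_mono mult_mono add_mono py np)
        have "real m * r \<le> (real m + 1) * r" using r by simp
        also have "\<dots> = \<eta> / (16 * D)"
        proof -
          have "k * (\<eta> / (16 * k * D)) = \<eta> / (16 * D)" if "k \<noteq> 0" for k using that by simp
          from this[of "real m + 1"] show ?thesis unfolding r_def by linarith
        qed
        finally show "real m * r \<le> \<eta> / (16 * D)" .
      qed (use Gx D r py_pos in auto)
      also have "\<dots> = real n * G x * (\<eta> / 8)" using D by (simp add: field_simps)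
      finally show ?thesis .
    qed
    have trunc_small: "\<eta> / 8 * c0 * x powr - \<gamma> \<le> real n * G x * (\<eta> / 8)"
    proof -
      have "c0 * x powr - \<gamma> \<le> 1 * G x" using low(3) elim(6) by simp
      also have "\<dots> \<le> real n * G x" using n Gx by (intro mult_right_mono) auto
      finally show ?thesis using \<open>0 < \<eta>\<close> by (simp add: field_simps)
    qed
    have nk: "real n * ln x \<le> \<kappa>1 * x\<^sup>2" "real n * ln x \<le> \<kappa>2 * x\<^sup>2"
      using order_trans[OF elim(8) mult_right_mono[OF \<kappa>(2)]]
        order_trans[OF elim(8) mult_right_mono[OF \<kappa>(3)]] by simp_all
    let ?S = "prob {\<omega>\<in>space M. (\<Sum>i=1..n. X (int i) \<omega>) > x}"
    have "?S \<le> real n * G x * (\<eta> / 8) + real n * G ((1 - \<delta>) * x) + real n * G x * (\<eta> / 8)"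
    proof -
      have "prob {\<omega>\<in>space M. (\<Sum>i=1..n. trunc y (X (int i) \<omega>)) > \<delta> * x} \<le> real n * G x * (\<eta> / 8)"
        unfolding y_def by (rule order_trans[OF T1(2)[OF _ nk(1)] trunc_small]) (use elim(6) in simp)
      then show ?thesis using prob_sum_gt_le[OF x_pos \<delta>(3,4), of n y] pairs
        unfolding G_def by linarith
    qed
    also have "real n * G ((1 - \<delta>) * x) \<le> real n * ((1 + \<eta> / 4) * G x)"
      using elim(1) Gx by (intro mult_left_mono) (auto simp: field_simps)
    finally have "?S \<le> real n * G x * (1 + \<eta> / 2)" by (simp add: algebra_simps)
    also have "\<dots> \<le> real n * G x * (1 + \<eta>)" using Gx \<open>0 < \<eta>\<close> by (intro mult_left_mono) auto
    finally have upper: "?S \<le> real n * G x * (1 + \<eta>)" .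
    have "real n * G x * (1 - \<eta>) \<le> real n * ((1 - \<eta> / 4) * G x) - 2 * (real n * G x * (\<eta> / 8)) - real n * G x * (\<eta> / 8)"
    proof -
      have "0 \<le> real n * G x * \<eta>" using Gx \<open>0 < \<eta>\<close> by simp
      then show ?thesis by (simp add: algebra_simps)
    qed
    also have "real n * ((1 - \<eta> / 4) * G x) \<le> real n * G ((1 + \<delta>) * x)"
      using elim(2) Gx by (intro mult_left_mono) (auto simp: field_simps)
    also have "real n * G ((1 + \<delta>) * x) - 2 * (real n * G x * (\<eta> / 8)) - real n * G x * (\<eta> / 8) \<le> ?S"
    proof -
      have "prob {\<omega>\<in>space M. (\<Sum>i=1..n. - trunc y (X (int i) \<omega>)) > \<delta> * x} \<le> real n * G x * (\<eta> / 8)"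
        unfolding y_def by (rule order_trans[OF T2(2)[OF _ nk(2)] trunc_small]) (use elim(6) in simp)
      then show ?thesis using prob_sum_gt_ge[OF x_pos \<delta>(3) y(2), of n] pairs
        unfolding G_def by linarith
    qed
    finally have lower: "real n * G x * (1 - \<eta>) \<le> ?S" by simp
    have N: "0 < real n * G x" using n Gx by simp
    have "?S / (real n * G x) \<le> 1 + \<eta>" using upper unfolding pos_divide_le_eq[OF N] by (simp only: mult.commute)
    moreover have "1 - \<eta> \<le> ?S / (real n * G x)" using lower unfolding pos_le_divide_eq[OF N] by (simp only: mult.commute)
    ultimately show "\<bar>?S / (real n * G x) - 1\<bar> \<le> \<eta>" by linarith
  qed
  then show ?thesis using \<kappa>(1) unfolding eventually_at_top_linorder by blast
qed

end

section \<open>From the growth condition to the uniform limit\<close>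

text \<open>Let \<open>w = sqrt (n ln n)\<close>, so that eventually \<open>x > K w\<close> for any given constant \<open>K\<close>. If \<open>x \<le> n\<^sup>2\<close>, then
  \<open>ln x \<le> 2 ln n\<close> and \<open>n ln x \<le> 2 w\<^sup>2 \<le> \<kappa> x\<^sup>2\<close>. If \<open>x > n\<^sup>2\<close>, then
  \<open>n ln x \<le> sqrt x ln x\<close>, which is \<open>o(x\<^sup>2)\<close>.\<close>

lemma eventually_log_regime:
  fixes t :: "nat \<Rightarrow> real"
  assumes growth: "filterlim (\<lambda>n. t n / sqrt (real n * ln (real n))) at_top sequentially"
    and "0 < \<delta>" "0 < \<kappa>"
  shows "eventually (\<lambda>n. \<forall>x>t n * \<delta>. x0 \<le> x \<and> real n * ln x \<le> \<kappa> * x\<^sup>2) sequentially"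
proof -
  have "((\<lambda>x. sqrt x * ln x / x\<^sup>2) \<longlongrightarrow> 0) at_top" by real_asymp
  then have "eventually (\<lambda>x. sqrt x * ln x / x\<^sup>2 < \<kappa>) at_top"
    using \<open>0 < \<kappa>\<close> by (rule order_tendstoD)
  then obtain x1 where x1: "\<And>x. x \<ge> x1 \<Longrightarrow> sqrt x * ln x / x\<^sup>2 < \<kappa>"
    by (auto simp: eventually_at_top_linorder)
  define b where "b = max x0 (max x1 1)"
  define K where "K = max 1 (2 / \<kappa>)"
  have K: "1 \<le> K" "2 / \<kappa> \<le> K" by (auto simp: K_def)
  have "eventually (\<lambda>n. K / \<delta> \<le> t n / sqrt (real n * ln (real n))) sequentially"
    using growth by (auto simp: filterlim_at_top)
  moreover have "eventually (\<lambda>n. b \<le> sqrt (real n * ln (real n))) sequentially"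
  proof -
    have "filterlim (\<lambda>n. sqrt (real n * ln (real n))) at_top sequentially" by real_asymp
    then show ?thesis by (auto simp: filterlim_at_top)
  qed
  moreover have "eventually (\<lambda>n. 2 \<le> n) sequentially" by (rule eventually_ge_at_top)
  ultimately show ?thesis
  proof (eventually_elim, intro allI impI conjI)
    fix n x
    assume elim: "K / \<delta> \<le> t n / sqrt (real n * ln (real n))" "b \<le> sqrt (real n * ln (real n))"
      "2 \<le> n" "t n * \<delta> < x"
    define w where "w = sqrt (real n * ln (real n))"
    have w: "b \<le> w" "0 < w" using elim(2) by (auto simp: w_def b_def)
    have ln_n: "0 \<le> ln (real n)" using elim(3) by simp
    have w2: "w\<^sup>2 = real n * ln (real n)" using ln_n by (simp add: w_def)
    have "K * w \<le> t n * \<delta>" using elim(1) w \<open>0 < \<delta>\<close> by (simp add: w_def[symmetric] field_simps)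
    then have xw: "K * w < x" using elim(4) by simp
    moreover have "1 * w \<le> K * w" using K w by (intro mult_right_mono) auto
    ultimately have x: "w < x" by simp
    then have xb: "x0 \<le> x" "x1 \<le> x" "1 \<le> x" using w by (auto simp: b_def)
    have "real n * ln x \<le> \<kappa> * x\<^sup>2"
    proof (cases "x \<le> (real n)\<^sup>2")
      case True
      then have "ln x \<le> 2 * ln (real n)" using xb elim(3) 
        by (metis ln_le_cancel_iff ln_realpow of_nat_0_less_iff of_nat_numeral order_less_le_trans zero_less_numeral zero_less_one zero_less_power)
      then have "real n * ln x \<le> 2 * w\<^sup>2" using mult_left_mono[of "ln x" _ "real n"] w2 by fastforce
      also have "\<dots> \<le> \<kappa> * (K * w)\<^sup>2"
      proof -
        have "2 \<le> \<kappa> * K" using K(2) \<open>0 < \<kappa>\<close> by (simp add: field_simps)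
        also have "\<dots> \<le> \<kappa> * K\<^sup>2" using K(1) \<open>0 < \<kappa>\<close> by (simp add: power2_eq_square)
        finally have "2 * w\<^sup>2 \<le> \<kappa> * K\<^sup>2 * w\<^sup>2" by (rule mult_right_mono) simp
        then show ?thesis by (simp add: power_mult_distrib)
      qed
      also have "\<dots> \<le> \<kappa> * x\<^sup>2" using xw K w \<open>0 < \<kappa>\<close> by (intro mult_left_mono power_mono) auto
      finally show ?thesis .
    next
      case False
      then have "real n \<le> sqrt x" by (simp add: real_le_rsqrt)
      then have "real n * ln x \<le> sqrt x * ln x" using xb by (intro mult_right_mono) auto
      also have "\<dots> \<le> \<kappa> * x\<^sup>2" using x1[OF xb(2)] xb(3) by (simp add: field_simps)
      finally show ?thesis .
    qed
    then show "x0 \<le> x" "real n * ln x \<le> \<kappa> * x\<^sup>2" using xb by simp_all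
  qed
qed

lemma slowly_varying_tail_ratio:
  fixes G L :: "real \<Rightarrow> real"
  assumes "slowly_varying L" and G: "\<And>x. 0 < x \<Longrightarrow> G x = L x * x powr - \<alpha>" and "0 < c"
  shows "((\<lambda>x. G (c * x) / G x) \<longlongrightarrow> c powr - \<alpha>) at_top"
proof -
  have "((\<lambda>x. L (c * x) / L x * c powr - \<alpha>) \<longlongrightarrow> 1 * c powr - \<alpha>) at_top"
    using assms by (intro tendsto_mult tendsto_const) (auto simp: slowly_varying_def)
  moreover have "eventually (\<lambda>x. L (c * x) / L x * c powr - \<alpha> = G (c * x) / G x) at_top"
    using eventually_gt_at_top[of 0]
  proof eventually_elim
    case (elim x)
    then show ?case using \<open>0 < c\<close> by (simp add: G powr_mult)
  qed
  ultimately show ?thesis using tendsto_cong by fastforce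
qed

text \<open>Tail balance transfers regular variation from the right tail to the tail of the absolute value.\<close>

lemma ratio_tendsto_of_equivalent:
  fixes G p :: "real \<Rightarrow> real"
  assumes ratio: "((\<lambda>x. G (c * x) / G x) \<longlongrightarrow> l) at_top" and "0 < c"
    and Gp: "((\<lambda>x. G x / p x) \<longlongrightarrow> k) at_top" and "0 < k"
  shows "((\<lambda>x. p (c * x) / p x) \<longlongrightarrow> l) at_top"
proof -
  have scale: "filterlim (\<lambda>x. c * x) at_top at_top"
    using \<open>0 < c\<close> by (intro filterlim_tendsto_pos_mult_at_top[OF tendsto_const] filterlim_ident)
  have Gp': "((\<lambda>x. G (c * x) / p (c * x)) \<longlongrightarrow> k) at_top"
    using filterlim_compose[OF Gp scale] .
  have "((\<lambda>x. (G (c * x) / G x) * (G x / p x) / (G (c * x) / p (c * x))) \<longlongrightarrow> l * k / k) at_top"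
    using \<open>0 < k\<close> by (intro tendsto_intros ratio Gp Gp') auto
  moreover have "eventually (\<lambda>x. 0 < G x / p x \<and> 0 < G (c * x) / p (c * x)) at_top"
    using order_tendstoD(1)[OF Gp \<open>0 < k\<close>] order_tendstoD(1)[OF Gp' \<open>0 < k\<close>] by (rule eventually_conj)
  then have "eventually (\<lambda>x. (G (c * x) / G x) * (G x / p x) / (G (c * x) / p (c * x)) = p (c * x) / p x) at_top"
  proof eventually_elim
    case (elim x)
    then have "G x \<noteq> 0" "p x \<noteq> 0" "G (c * x) \<noteq> 0" "p (c * x) \<noteq> 0" by auto
    then show ?case by (simp add: field_simps)
  qed
  ultimately show ?thesis using \<open>0 < k\<close> tendsto_cong by fastforce
qed

lemma (in prob_space) right_tail_eq_prob:
  assumes [measurable]: "Y \<in> borel_measurable M"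
  shows "right_tail M Y x = prob {\<omega>\<in>space M. Y \<omega> > x}"
proof -
  have "cdf (distr M borel Y) x = prob {\<omega>\<in>space M. Y \<omega> \<le> x}"
    unfolding cdf_def by (subst measure_distr) (auto intro!: arg_cong[where f = prob])
  moreover have "prob {\<omega>\<in>space M. \<not> Y \<omega> \<le> x} = 1 - prob {\<omega>\<in>space M. Y \<omega> \<le> x}"
    by (rule prob_neg) measurable
  ultimately show ?thesis by (simp add: right_tail_def not_le)
qed

theorem theorem3p2:
  fixes M :: "'w measure" and X :: "int \<Rightarrow> 'w \<Rightarrow> real" and m :: nat
    and \<alpha> p_plus p_minus :: real and L :: "real \<Rightarrow> real" and t :: "nat \<Rightarrow> real"
  assumes "prob_space M"
    and "m \<ge> 1"
    and "strictly_stationary M X"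
    and "m_dependent M m X"
    and "integrable M (X 0)" and "(\<integral>\<omega>. X 0 \<omega> \<partial>M) = 0"
    and "\<alpha> > 2"
    and "regularly_varying_sequence M X \<alpha>"
    and t_pos: "\<And>n. n \<ge> 1 \<Longrightarrow> t n > 0"
    and RV1: "filterlim (\<lambda>n. t n / sqrt (real n * ln (real n))) at_top sequentially"
    and RV2_L: "slowly_varying L"
    and RV2_tail: "\<And>x. x > 0 \<Longrightarrow> right_tail M (X 0) x = L x * x powr (- \<alpha>)"
    and RV2_plus: "((\<lambda>x. measure M {\<omega> \<in> space M. X 0 \<omega> > x} /
                         measure M {\<omega> \<in> space M. \<bar>X 0 \<omega>\<bar> > x}) \<longlongrightarrow> p_plus) at_top"
    and RV2_minus: "((\<lambda>x. measure M {\<omega> \<in> space M. - X 0 \<omega> > x} /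
                          measure M {\<omega> \<in> space M. \<bar>X 0 \<omega>\<bar> > x}) \<longlongrightarrow> p_minus) at_top"
    and "p_plus > 0" and "p_minus \<ge> 0"
    and RV3: "\<And>h::nat. 1 \<le> h \<Longrightarrow> h \<le> m \<Longrightarrow>
        ((\<lambda>x. cond_prob M (\<lambda>\<omega>. \<bar>X (int h) \<omega>\<bar> > x) (\<lambda>\<omega>. \<bar>X 0 \<omega>\<bar> > x)) \<longlongrightarrow> 0) at_top"
  shows "\<forall>\<delta>>0. (\<lambda>n. SUP x\<in>{t n * \<delta><..}.
           ereal \<bar>measure M {\<omega> \<in> space M. (\<Sum>i=1..n. X (int i) \<omega>) > x} /
                  (real n * right_tail M (X 0) x) - 1\<bar>) \<longlonglongrightarrow> 0"
proof -
  interpret m_dependent_process M X m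
    using assms(1,3,4) by (simp add: m_dependent_process_def m_dependent_process_axioms_def)
  define G where "G x = prob {\<omega>\<in>space M. X 0 \<omega> > x}" for x
  define p where "p x = prob {\<omega>\<in>space M. \<bar>X 0 \<omega>\<bar> > x}" for x
  have tail: "right_tail M (X 0) x = G x" for x
    unfolding G_def by (rule right_tail_eq_prob) measurable
  have G_eq: "G x = L x * x powr - \<alpha>" if "0 < x" for x
    using RV2_tail[OF that] tail by simp
  have Gratio: "((\<lambda>x. G (c * x) / G x) \<longlongrightarrow> c powr - \<alpha>) at_top" if "0 < c" for c
    using slowly_varying_tail_ratio[OF RV2_L G_eq that] .
  obtain a where "0 < a" "\<And>x. a \<le> x \<Longrightarrow> 0 < L x"
    using RV2_L by (auto simp: slowly_varying_def)
  then have Gpos: "0 < G x" if "a \<le> x" for x using that by (simp add: G_eq)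
  have Gp: "((\<lambda>x. G x / p x) \<longlongrightarrow> p_plus) at_top" using RV2_plus by (simp add: G_def p_def)
  have "eventually (\<lambda>x. p_plus / 2 < G x / p x) at_top"
    using Gp by (rule order_tendstoD) (use \<open>p_plus > 0\<close> in simp)
  then have pG: "eventually (\<lambda>x. p x \<le> 2 / p_plus * G x) at_top"
  proof eventually_elim
    case (elim x)
    then have "p x \<noteq> 0" using \<open>p_plus > 0\<close> by auto
    then have "0 < p x" by (simp add: p_def zero_less_measure_iff)
    then show ?case using elim \<open>p_plus > 0\<close> by (simp add: field_simps)
  qed
  \<comment> \<open>Any exponents \<open>2 < q < \<beta> < \<alpha>\<close> would do: dyadic decay at rate \<open>\<beta>\<close> gives the moment of order \<open>q\<close>.\<close>
  define q where "q = (2 + \<alpha>) / 2"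
  define \<beta> where "\<beta> = (q + \<alpha>) / 2"
  have q: "2 < q" "q < \<beta>" "\<beta> < \<alpha>" using \<open>\<alpha> > 2\<close> by (simp_all add: q_def \<beta>_def field_simps)
  have intq: "integrable M (\<lambda>\<omega>. \<bar>X 0 \<omega>\<bar> powr q)"
  proof -
    have "((\<lambda>x. p (2 * x) / p x) \<longlongrightarrow> 2 powr - \<alpha>) at_top"
      using ratio_tendsto_of_equivalent[OF Gratio _ Gp \<open>p_plus > 0\<close>, of 2] by simp
    then have "eventually (\<lambda>x. p (2 * x) / p x < 2 powr - \<beta>) at_top"
      by (rule order_tendstoD) (use q in simp)
    then have "eventually (\<lambda>x. p (2 * x) \<le> 2 powr - \<beta> * p x) at_top"
      using eventually_ge_at_top[of a]
    proof eventually_elim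
      case (elim x)
      have "G x \<le> p x" unfolding G_def p_def by (intro finite_measure_mono) auto
      then have "0 < p x" using Gpos[OF elim(2)] by linarith
      then show ?case using elim by (simp add: field_simps)
    qed
    then obtain x0 where "\<And>x. x0 \<le> x \<Longrightarrow> p (2 * x) \<le> 2 powr - \<beta> * p x"
      by (auto simp: eventually_at_top_linorder)
    then show ?thesis
      using q by (intro integrable_abs_powr_of_dyadic_decay[where ?x0.0 = x0 and \<beta> = \<beta>]) (auto simp: p_def)
  qed
  have int2: "integrable M (\<lambda>\<omega>. (X 0 \<omega>)\<^sup>2)"
  proof (rule Bochner_Integration.integrable_bound)
    show "integrable M (\<lambda>\<omega>. 1 + \<bar>X 0 \<omega>\<bar> powr q)" using intq by simp
    have "v\<^sup>2 \<le> 1 + \<bar>v\<bar> powr q" for v :: real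
    proof (cases "\<bar>v\<bar> \<le> 1")
      case True
      then have "v\<^sup>2 \<le> 1" by (simp add: abs_square_le_1)
      then show ?thesis by (simp add: add_increasing2)
    next
      case False
      then have "\<bar>v\<bar> powr 2 \<le> \<bar>v\<bar> powr q" using q by (intro powr_mono) auto
      moreover have "\<bar>v\<bar> powr 2 = v\<^sup>2" using False by simp
      ultimately show ?thesis by simp
    qed
    then show "AE \<omega> in M. norm ((X 0 \<omega>)\<^sup>2) \<le> norm (1 + \<bar>X 0 \<omega>\<bar> powr q)" by (intro AE_I2) simp
  qed measurable
  have anti_cluster: "((\<lambda>x. prob {\<omega>\<in>space M. \<bar>X 0 \<omega>\<bar> > x \<and> \<bar>X (int h) \<omega>\<bar> > x} / p x) \<longlongrightarrow> 0) at_top"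
    if "1 \<le> h" "h \<le> m" for h :: nat
    using RV3[OF that] by (simp add: cond_prob_def p_def conj_commute)
  show ?thesis
  proof (intro allI impI)
    fix \<delta> :: real assume "0 < \<delta>"
    let ?r = "\<lambda>n x. \<bar>measure M {\<omega> \<in> space M. (\<Sum>i=1..n. X (int i) \<omega>) > x} /
                  (real n * right_tail M (X 0) x) - 1\<bar>"
    show "(\<lambda>n. SUP x\<in>{t n * \<delta><..}. ereal (?r n x)) \<longlonglongrightarrow> 0"
    proof (rule order_tendstoI)
      fix l :: ereal assume "l < 0"
      have "0 \<le> (SUP x\<in>{t n * \<delta><..}. ereal (?r n x))" for n
        by (rule SUP_upper2[where i = "t n * \<delta> + 1"]) auto
      then show "eventually (\<lambda>n. l < (SUP x\<in>{t n * \<delta><..}. ereal (?r n x))) sequentially"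
        using \<open>l < 0\<close> by (intro always_eventually allI) (rule less_le_trans)
    next
      fix u :: ereal assume "0 < u"
      then obtain \<eta> where \<eta>: "0 < ereal \<eta>" "ereal \<eta> < u" using ereal_dense2 by blast
      obtain \<kappa> x0 where core: "0 < \<kappa>" "\<And>x n. x0 \<le> x \<Longrightarrow> 1 \<le> n \<Longrightarrow> real n * ln x \<le> \<kappa> * x\<^sup>2 \<Longrightarrow>
          \<bar>prob {\<omega>\<in>space M. (\<Sum>i=1..n. X (int i) \<omega>) > x} / (real n * G x) - 1\<bar> \<le> \<eta>"
        using big_jump_uniform[of q \<alpha> a "2 / p_plus" \<eta>, folded G_def p_def,
            OF assms(5,6) int2 intq q(1) Gratio Gpos pG _ anti_cluster] \<eta>(1) \<open>p_plus > 0\<close>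
        by auto
      show "eventually (\<lambda>n. (SUP x\<in>{t n * \<delta><..}. ereal (?r n x)) < u) sequentially"
        using eventually_log_regime[OF RV1 \<open>0 < \<delta>\<close> core(1), of x0] eventually_ge_at_top[of 1]
      proof eventually_elim
        case (elim n)
        have "(SUP x\<in>{t n * \<delta><..}. ereal (?r n x)) \<le> ereal \<eta>"
          using elim core(2) by (intro SUP_least) (auto simp: tail)
        then show ?case using \<eta>(2) by (rule le_less_trans)
      qed
    qed
  qed
qed

end
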